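(* Let $\Omega\subset\mathbb{C}$ be a domain which is symmetric with respect to the real axis and whose boundary $b\Omega$ is a real analytic simple closed curve. Let $r>0$ and let $f$ be a continuous complex-valued function on $$K=\bigcup\{\,b\Omega+it:\ -r\le t\le r\,\}$$ such that for each $t$, $-r\le t\le r$, the function $f|(b\Omega+it)$ has a continuous extension to $\overline\Omega+it$ which is holomorphic on $\Omega+it$. Suppose that $(\overline\Omega-ir)\cap(\overline\Omega+ir)=\emptyset$. Then $f$ is holomorphic on $\mathrm{Int}\,K$.
   Context: For a set $A\subset\mathbb{C}$ and $c\in\mathbb{C}$, $A+c=\{z+c: z\in A\}$; $bA$ denotes the (topological) boundary of a domain $A$, $\overline A$ its closure, and $\mathrm{Int}\,A$ the interior of $A$ in $\mathbb{C}$. Symmetric with respect to the real axis means invariant under $z\mapsto\overline z$ (complex conjugation). *)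

theory Defs
  imports "HOL-Complex_Analysis.Complex_Analysis"
begin

definition real_analytic :: "(real \<Rightarrow> complex) \<Rightarrow> bool" where
  "real_analytic \<gamma> \<longleftrightarrow>
     (\<forall>s. \<exists>a :: nat \<Rightarrow> complex. \<exists>e>0. \<forall>t. \<bar>t - s\<bar> < e \<longrightarrow>
        (\<lambda>n. a n * of_real (t - s) ^ n) sums \<gamma> t)"

text \<open>
  The parametrization is required to be analytic on the circle, not just on a closed interval,
  hence the 1-periodic \<open>\<gamma>\<close> on the whole line; \<open>simple_path\<close> and \<open>path_image\<close> only look at
  \<open>\<gamma>\<close> on \<open>{0..1}\<close>, and periodicity gives \<open>\<gamma> 1 = \<gamma> 0\<close>. The parametrization is regular
  (nonvanishing velocity), so that cusps are excluded.
\<close>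
definition real_analytic_simple_closed_curve :: "complex set \<Rightarrow> bool" where
  "real_analytic_simple_closed_curve C \<longleftrightarrow>
     (\<exists>\<gamma>. real_analytic \<gamma> \<and> (\<forall>t. \<gamma> (t + 1) = \<gamma> t) \<and>
          (\<forall>t. vector_derivative \<gamma> (at t) \<noteq> 0) \<and>
          simple_path \<gamma> \<and> path_image \<gamma> = C)"

definition translate :: "complex set \<Rightarrow> complex \<Rightarrow> complex set" where
  "translate A c = (\<lambda>z. z + c) ` A"

definition vertical_sweep :: "complex set \<Rightarrow> real \<Rightarrow> complex set" where
  "vertical_sweep C r = (\<Union>t\<in>{-r..r}. translate C (\<i> * of_real t))"

end

theory Submission
  imports Defs
begin

text \<open>
  Write \<open>G s t\<close> for the value at \<open>s + \<i>t\<close> of the extension of \<open>f\<close> from \<open>b\<Omega> + \<i>t\<close>, and let \<open>m < r\<close> be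
  the half-height of \<open>\<Omega>\<close>. A Riemann map \<open>\<phi>\<close> from the disc onto \<open>\<Omega>\<close> can be chosen to commute with
  conjugation. Then \<open>log (J(\<zeta>) - J(q))\<close>, with \<open>J(\<zeta>) = \<zeta> + 1/\<zeta>\<close>, has the same differential at \<open>\<zeta>\<close> and at
  \<open>1/\<zeta>\<close>, so it gives a Cauchy kernel on the circle which is odd under conjugation. Multiply \<open>G\<close> by a
  holomorphic test function \<open>V(s + \<i>t)\<close>, integrate against the difference of the kernels of two points \<open>s1\<close>,
  \<open>s2\<close> and over \<open>-r \<le> t \<le> r\<close>: since the points \<open>s\<close> and \<open>cnj s\<close> of \<open>b\<Omega>\<close> sweep the same vertical line, all
  contributions cancel except those from heights \<open>|y| \<ge> r - m\<close>. Choosing \<open>V\<close> bounded there but exponentially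
  large near a prescribed point of the line \<open>Re z = Re s1 = Re s2\<close> shows that two extensions agree at every
  point with \<open>|y| < r - m\<close> where both are defined. By analytic continuation the value \<open>G (z - \<i>t) t\<close> is then
  locally constant in \<open>t\<close>, and since \<open>z - \<i>r\<close> and \<open>z + \<i>r\<close> are never both in \<open>\<Omega>\<close>, one can move \<open>t\<close> until
  \<open>z - \<i>t\<close> reaches \<open>b\<Omega>\<close>, where the value is \<open>f z\<close>. So \<open>f\<close> is holomorphic on the sweep of \<open>\<Omega>\<close>; the
  remaining interior points of \<open>K\<close> lie on finitely many vertical lines, through points where \<open>b\<Omega>\<close> has a
  vertical tangent, and lines are removable for continuous functions.
\<close>

section \<open>Test functions concentrated on a vertical line\<close>

text \<open>Cauchy-type integral of a continuous density: the case \<open>k = 1\<close> of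
  \<open>Cauchy_next_derivative\<close> differentiates under the integral sign.\<close>

lemma holomorphic_on_Cauchy_integral_linepath:
  assumes h: "continuous_on (closed_segment a b) h" and S: "open S" "S \<inter> closed_segment a b = {}"
  shows "(\<lambda>z. contour_integral (linepath a b) (\<lambda>w. h w / (w - z))) holomorphic_on S"
proof -
  have int: "((\<lambda>u. h u / (u - w) ^ 1) has_contour_integral
        contour_integral (linepath a b) (\<lambda>u. h u / (u - w))) (linepath a b)"
    if "w \<in> S - path_image (linepath a b)" for w
  proof -
    have "continuous_on (closed_segment a b) (\<lambda>u. h u / (u - w))"
      using that S by (intro continuous_intros h) auto
    then show ?thesis
      by (simp add: contour_integrable_continuous_linepath has_contour_integral_integral)
  qed
  have "(\<lambda>z. contour_integral (linepath a b) (\<lambda>w. h w / (w - z))) field_differentiable at w"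
    if w: "w \<in> S" for w
    unfolding field_differentiable_def
    by (rule exI, rule Cauchy_next_derivative(2)[where k = 1 and B = "norm (b - a)" and S = S, OF _ _ int])
       (use h S w in auto)
  then show ?thesis
    by (auto simp: holomorphic_on_def intro: field_differentiable_at_within)
qed

text \<open>The winding number of the rectangle is 1 or 0, so one identity serves both uses below:
  half-height \<open>pi\<close> with \<open>z\<close> inside, and half-height \<open>pi/2\<close>
  with \<open>z\<close> outside.\<close>

lemma contour_integral_rectangle_Cauchy:
  fixes E :: "complex \<Rightarrow> complex"
  assumes E: "E holomorphic_on UNIV" and XY: "0 < X" "0 < Y"
    and z: "\<bar>Re z\<bar> \<noteq> X" "\<bar>Im z\<bar> \<noteq> Y"
  defines "I \<equiv> \<lambda>a b. contour_integral (linepath a b) (\<lambda>w. E w / (w - z))"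
  shows "I (Complex (-X) (-Y)) (Complex X (-Y)) + I (Complex X (-Y)) (Complex X Y) +
         I (Complex X Y) (Complex (-X) Y) + I (Complex (-X) Y) (Complex (-X) (-Y)) =
         2 * of_real pi * \<i> * (if \<bar>Re z\<bar> < X \<and> \<bar>Im z\<bar> < Y then E z else 0)"
proof -
  define P where "P = rectpath (Complex (-X) (-Y)) (Complex X Y)"
  have im: "path_image P \<subseteq> - {z}"
    using XY z unfolding P_def
    by (subst path_image_rectpath) (auto simp: closed_segment_same_Re closed_segment_same_Im closed_segment_eq_real_ivl)
  have cont: "continuous_on (closed_segment a b) (\<lambda>w. E w / (w - z))"
    if "z \<notin> closed_segment a b" for a b
    using that by (intro continuous_intros holomorphic_on_imp_continuous_on[OF holomorphic_on_subset[OF E]]) auto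
  have ci: "(\<lambda>w. E w / (w - z)) contour_integrable_on linepath a b"
    if "z \<notin> closed_segment a b" for a b
    using cont[OF that] by (rule contour_integrable_continuous_linepath)
  have "((\<lambda>w. E w / (w - z)) has_contour_integral (2*pi * \<i> * winding_number P z * E z)) P"
    by (rule Cauchy_integral_formula_convex_simple[where S = UNIV]) (use E im in \<open>auto simp: P_def\<close>)
  then have 1: "contour_integral P (\<lambda>w. E w / (w - z)) = 2*pi * \<i> * winding_number P z * E z"
    by (rule contour_integral_unique)
  have 2: "winding_number P z = (if \<bar>Re z\<bar> < X \<and> \<bar>Im z\<bar> < Y then 1 else 0)"
  proof (cases "\<bar>Re z\<bar> < X \<and> \<bar>Im z\<bar> < Y")
    case True
    then show ?thesis
      unfolding P_def by (subst winding_number_rectpath) (auto simp: in_box_complex_iff)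
  next
    case False
    then have "z \<notin> cbox (Complex (-X) (-Y)) (Complex X Y)"
      using z by (auto simp: in_cbox_complex_iff)
    then show ?thesis
      using False XY unfolding P_def by (subst winding_number_rectpath_outside) auto
  qed
  have 3: "contour_integral P (\<lambda>w. E w / (w - z)) =
      I (Complex (-X) (-Y)) (Complex X (-Y)) + I (Complex X (-Y)) (Complex X Y) +
         I (Complex X Y) (Complex (-X) Y) + I (Complex (-X) Y) (Complex (-X) (-Y))"
  proof -
    have nin: "z \<notin> closed_segment (Complex (-X) (-Y)) (Complex X (-Y))"
       "z \<notin> closed_segment (Complex X (-Y)) (Complex X Y)"
       "z \<notin> closed_segment (Complex X Y) (Complex (-X) Y)"
       "z \<notin> closed_segment (Complex (-X) Y) (Complex (-X) (-Y))"
      using z XY by (auto simp: closed_segment_same_Re closed_segment_same_Im)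
    show ?thesis
      unfolding P_def rectpath_def I_def Let_def
      by (simp add: ci nin contour_integrable_join valid_path_join)
  qed
  show ?thesis
    using 1 2 3 by auto
qed

text \<open>
  \<open>V N\<close> is the Cauchy transform of \<open>exp (N cosh w)\<close> over the two vertical sides of a rectangle. Completing
  the contour by horizontal sides, on which \<open>exp (N cosh w)\<close> is bounded by 1, cuts this function off
  outside the strip where it is large.
\<close>

lemma strip_peak_functions:
  fixes L :: real
  assumes "0 < L"
  obtains V :: "nat \<Rightarrow> complex \<Rightarrow> complex" and C where
    "\<And>N. V N holomorphic_on {z. \<bar>Re z\<bar> < L + 1}"
    "\<And>N z. \<bar>Re z\<bar> \<le> L \<Longrightarrow> 3*pi/4 \<le> \<bar>Im z\<bar> \<Longrightarrow> norm (V N z) \<le> C"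
    "\<And>N y. \<bar>y\<bar> \<le> 3*pi/4 \<Longrightarrow> norm (V N (\<i> * of_real y) - exp (of_real (of_nat N * cos y))) \<le> C"
proof -
  define X where "X = L + 1"
  have X: "0 < X" using assms by (simp add: X_def)
  \<comment> \<open>This is exp (N cosh w). Its modulus is exp (N cosh (Re w) cos (Im w)): at most 1
    where the cosine is nonpositive, and equal to exp (N cos y), peaked at \<open>y = 0\<close>, on
    the imaginary axis.\<close>
  define E where "E = (\<lambda>N w :: complex. exp (of_nat N * ((exp w + exp (-w))/2)))"
  have Ehol: "E N holomorphic_on UNIV" for N
    unfolding E_def by (intro holomorphic_intros) auto
  have Re_cosh: "Re ((exp w + exp (-w))/2) = cosh (Re w) * cos (Im w)" for w
    by (simp add: Re_exp cosh_field_def field_simps)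
  have normE: "norm (E N w) = exp (of_nat N * (cosh (Re w) * cos (Im w)))" for N w
  proof -
    have "Re (of_nat N * u) = of_nat N * Re u" for u :: complex by simp
    then show ?thesis unfolding E_def norm_exp_eq_Re by (simp only: Re_cosh)
  qed
  have E1: "norm (E N w) \<le> 1" if "cos (Im w) \<le> 0" for N w
    using that by (auto simp: normE mult_nonneg_nonpos cosh_real_pos less_imp_le)
  define I where "I = (\<lambda>N z a b. contour_integral (linepath a b) (\<lambda>w. E N w / (w - z)))"
  define V where "V = (\<lambda>N z. (I N z (Complex X (-pi)) (Complex X pi) +
      I N z (Complex (-X) pi) (Complex (-X) (-pi))) / (2 * of_real pi * \<i>))"
  \<comment> \<open>The budget of the worse case: four pieces of vertical sides at
    \<open>pi/2\<close> each and two horizontal sides at \<open>8*X/pi\<close> each.\<close>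
  define C where "C = (2*pi + 16*X/pi) / (2*pi)"
  have cont: "continuous_on (closed_segment a b) (\<lambda>w. E N w / (w - z))"
    if "z \<notin> closed_segment a b" for a b z N
    using that by (intro continuous_intros holomorphic_on_imp_continuous_on[OF holomorphic_on_subset[OF Ehol]]) auto
  have Ibound: "norm (I N z a b) \<le> inverse d * norm (b - a)"
    if "0 < d" "\<And>w. w \<in> closed_segment a b \<Longrightarrow> cos (Im w) \<le> 0 \<and> d \<le> norm (w - z)" for N z a b d
  proof -
    have "norm (E N w / (w - z)) \<le> inverse d" if "w \<in> closed_segment a b" for w
    proof -
      have "norm (E N w / (w - z)) \<le> 1 / d"
        using that \<open>0 < d\<close> E1[of w N] \<open>\<And>w. w \<in> closed_segment a b \<Longrightarrow> cos (Im w) \<le> 0 \<and> d \<le> norm (w - z)\<close>[OF that]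
        unfolding norm_divide by (intro frac_le) auto
      then show ?thesis by (simp add: field_simps)
    qed
    moreover have "(\<lambda>w. E N w / (w - z)) contour_integrable_on linepath a b"
      using that by (intro contour_integrable_continuous_linepath cont) force
    ultimately show ?thesis
      unfolding I_def using \<open>0 < d\<close> by (intro contour_integral_bound_linepath) auto
  qed
  have cos2: "cos y \<le> 0" if "pi/2 \<le> \<bar>y\<bar>" "\<bar>y\<bar> \<le> pi" for y :: real
  proof -
    have "cos y = cos \<bar>y\<bar>" by (simp add: abs_if)
    then show ?thesis using that cos_monotone_0_pi_le[of "pi/2" "\<bar>y\<bar>"] by auto
  qed
  \<comment> \<open>The threshold \<open>3*pi/4\<close> is halfway between \<open>pi/2\<close> and
    \<open>pi\<close>: points above it keep distance \<open>pi/4\<close> from the sides at height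
    \<open>pi/2\<close>, points below it from those at height \<open>pi\<close>. The sign
    \<open>s\<close> gives the orientation.\<close>
  have horiz: "norm (I N z (Complex (s*X) y) (Complex (-s*X) y)) \<le> 4/pi * (2 * X)"
    if "s = 1 \<or> s = -1" "\<bar>y\<bar> = pi/2 \<or> \<bar>y\<bar> = pi" "pi/4 \<le> \<bar>\<bar>y\<bar> - \<bar>Im z\<bar>\<bar>" for N z y s
  proof -
    have "norm (I N z (Complex (s*X) y) (Complex (-s*X) y)) \<le>
        inverse (pi/4) * norm (Complex (-s*X) y - Complex (s*X) y)"
    proof (rule Ibound)
      fix w assume "w \<in> closed_segment (Complex (s * X) y) (Complex (- s * X) y)"
      then have w: "Im w = y" by (auto simp: closed_segment_same_Im)
      have "\<bar>y - Im z\<bar> \<le> norm (w - z)" using abs_Im_le_cmod[of "w - z"] w by simp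
      moreover have "\<bar>\<bar>y\<bar> - \<bar>Im z\<bar>\<bar> \<le> \<bar>y - Im z\<bar>" by linarith
      moreover have "cos y \<le> 0"
        using that(2) pi_gt_zero by (intro cos2) linarith+
      ultimately show "cos (Im w) \<le> 0 \<and> pi/4 \<le> norm (w - z)"
        using that(3) unfolding w by linarith
    qed auto
    also have "norm (Complex (-s*X) y - Complex (s*X) y) = norm (of_real (-2 * s * X) :: complex)"
      by (rule arg_cong[where f = norm]) (simp add: complex_eq_iff)
    also have "\<dots> = 2 * X"
      using that(1) X by (auto simp: norm_mult)
    finally show ?thesis by simp
  qed
  \<comment> \<open>The vertical sides stand at \<open>X = L + 1\<close>, hence at distance at least
    1 from \<open>z\<close>.\<close>
  have vert: "norm (I N z (Complex (s*X) a) (Complex (s*X) b)) \<le> pi/2"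
    if "s = 1 \<or> s = -1" "\<bar>b - a\<bar> = pi/2" "\<And>y. y \<in> closed_segment a b \<Longrightarrow> pi/2 \<le> \<bar>y\<bar> \<and> \<bar>y\<bar> \<le> pi"
       "\<bar>Re z\<bar> \<le> L" for N z a b s
  proof -
    have "norm (I N z (Complex (s*X) a) (Complex (s*X) b)) \<le>
        inverse 1 * norm (Complex (s*X) b - Complex (s*X) a)"
    proof (rule Ibound)
      fix w assume "w \<in> closed_segment (Complex (s*X) a) (Complex (s*X) b)"
      then have "Re w = s * X" "Im w \<in> closed_segment a b" by (auto simp: closed_segment_same_Re)
      moreover have "\<bar>Re (w - z)\<bar> \<le> norm (w - z)" by (rule abs_Re_le_cmod)
      ultimately show "cos (Im w) \<le> 0 \<and> 1 \<le> norm (w - z)"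
        using that cos2[of "Im w"] by (auto simp: X_def)
    qed auto
    also have "norm (Complex (s*X) b - Complex (s*X) a) = norm (\<i> * of_real (b - a))"
      by (rule arg_cong[where f = norm]) (simp add: complex_eq_iff)
    also have "\<dots> = pi/2"
      unfolding norm_mult norm_of_real that(2) by simp
    finally show ?thesis by simp
  qed
  have C: "norm W / (2*pi) \<le> C" if "norm W \<le> 2*pi + 16*X/pi" for W :: complex
    using that unfolding C_def by (intro divide_right_mono) auto
  show thesis
  proof
    show "V N holomorphic_on {z. \<bar>Re z\<bar> < L + 1}" for N
    proof -
      have op: "open {z. \<bar>Re z\<bar> < L + 1}"
        by (intro open_Collect_less continuous_intros)
      have "(\<lambda>z. I N z (Complex (s*X) a) (Complex (s*X) b)) holomorphic_on {z. \<bar>Re z\<bar> < L + 1}"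
        if "s = 1 \<or> s = -1" for s a b
        unfolding I_def
        by (intro holomorphic_on_Cauchy_integral_linepath holomorphic_on_imp_continuous_on
            holomorphic_on_subset[OF Ehol] op)
           (use that X in \<open>auto simp: X_def closed_segment_same_Re\<close>)
      from this[of 1] this[of "-1"] show ?thesis
        unfolding V_def by (intro holomorphic_intros) auto
    qed
    show "norm (V N z) \<le> C" if z: "\<bar>Re z\<bar> \<le> L" "3*pi/4 \<le> \<bar>Im z\<bar>" for N z
    proof -
      have zX: "\<bar>Re z\<bar> < X" using z by (simp add: X_def)
      have zI: "pi/2 < \<bar>Im z\<bar>" using z pi_gt_zero by linarith
      have cs: "closed_segment (-pi) pi = {-pi..pi}" "closed_segment pi (-pi) = {-pi..pi}"
        "closed_segment (-(pi/2)) pi = {-(pi/2)..pi}" "closed_segment (pi/2) (-pi) = {-pi..pi/2}"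
        and pm: "- (pi/2) \<le> pi"
        using pi_gt_zero by (simp_all add: closed_segment_eq_real_ivl not_le del: pi_gt_zero)
      have split: "I N z (Complex (s*X) a) (Complex (s*X) b) =
          I N z (Complex (s*X) a) (Complex (s*X) c) + I N z (Complex (s*X) c) (Complex (s*X) b)"
        if "s = 1 \<or> s = -1" "c \<in> closed_segment a b" for s a b c
        unfolding I_def
        by (rule contour_integral_split_linepath, rule cont)
           (use that zX in \<open>auto simp: closed_segment_same_Re\<close>)
      \<comment> \<open>The parts of the vertical sides with |Im w| < \<open>pi/2\<close>, where
        \<open>E\<close> is large, are traded for horizontal sides at heights \<open>pi/2\<close>
        and \<open>-(pi/2)\<close>: the smaller rectangle excludes \<open>z\<close>, so its contour
        integral vanishes.\<close>
      have *: "I N z (Complex (-X) (-(pi/2))) (Complex X (-(pi/2))) + I N z (Complex X (-(pi/2))) (Complex X (pi/2)) +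
         I N z (Complex X (pi/2)) (Complex (-X) (pi/2)) + I N z (Complex (-X) (pi/2)) (Complex (-X) (-(pi/2))) = 0"
        unfolding I_def using X zX zI pi_gt_zero
        by (subst contour_integral_rectangle_Cauchy[OF Ehol]) auto
      have R: "I N z (Complex X (-pi)) (Complex X pi) = I N z (Complex X (-pi)) (Complex X (-(pi/2))) +
          I N z (Complex X (-(pi/2))) (Complex X (pi/2)) + I N z (Complex X (pi/2)) (Complex X pi)"
        using split[of 1 "-(pi/2)" "-pi" "pi"] split[of 1 "pi/2" "-(pi/2)" pi] pm by (simp add: cs)
      have Le: "I N z (Complex (-X) pi) (Complex (-X) (-pi)) = I N z (Complex (-X) pi) (Complex (-X) (pi/2)) +
          I N z (Complex (-X) (pi/2)) (Complex (-X) (-(pi/2))) + I N z (Complex (-X) (-(pi/2))) (Complex (-X) (-pi))"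
        using split[of "-1" "pi/2" "pi" "-pi"] split[of "-1" "-(pi/2)" "pi/2" "-pi"] by (simp add: cs)
      let ?v1 = "I N z (Complex X (-pi)) (Complex X (-(pi/2)))"
      let ?v2 = "I N z (Complex X (pi/2)) (Complex X pi)"
      let ?v3 = "I N z (Complex (-X) pi) (Complex (-X) (pi/2))"
      let ?v4 = "I N z (Complex (-X) (-(pi/2))) (Complex (-X) (-pi))"
      let ?h1 = "I N z (Complex (-X) (-(pi/2))) (Complex X (-(pi/2)))"
      let ?h2 = "I N z (Complex X (pi/2)) (Complex (-X) (pi/2))"
      define W where "W = I N z (Complex X (-pi)) (Complex X pi) + I N z (Complex (-X) pi) (Complex (-X) (-pi))"
      have W: "W = ?v1 + ?v2 + ?v3 + ?v4 - ?h1 - ?h2"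
        unfolding W_def R Le using * by (simp add: algebra_simps eq_neg_iff_add_eq_0)
      have "norm ?v1 \<le> pi/2" "norm ?v2 \<le> pi/2" "norm ?v3 \<le> pi/2" "norm ?v4 \<le> pi/2"
        using vert[of 1 "-(pi/2)" "-pi" z N] vert[of 1 pi "pi/2" z N] vert[of "-1" "pi/2" pi z N]
          vert[of "-1" "-pi" "-(pi/2)" z N] z
        by (auto simp: closed_segment_eq_real_ivl)
      moreover have "norm ?h1 \<le> 8*X/pi" "norm ?h2 \<le> 8*X/pi"
        using horiz[of "-1" "-(pi/2)" z N] horiz[of "1" "pi/2" z N] z by auto
      moreover have "norm W \<le> norm ?v1 + norm ?v2 + norm ?v3 + norm ?v4 + norm ?h1 + norm ?h2"
        unfolding W by norm
      ultimately have "norm W \<le> pi/2 + pi/2 + pi/2 + pi/2 + 8*X/pi + 8*X/pi"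
        by linarith
      then have "norm W \<le> 2*pi + 16*X/pi" by (simp add: field_simps)
      from C[OF this] show ?thesis
        by (simp add: V_def W_def[symmetric] norm_divide norm_mult)
    qed
    show "norm (V N (\<i> * of_real y) - exp (of_real (of_nat N * cos y))) \<le> C"
      if y: "\<bar>y\<bar> \<le> 3*pi/4" for N y
    proof -
      let ?z = "\<i> * of_real y"
      let ?h1 = "I N ?z (Complex (-X) (-pi)) (Complex X (-pi))"
      let ?h2 = "I N ?z (Complex X pi) (Complex (-X) pi)"
      have yp: "\<bar>y\<bar> < pi" using y pi_gt_zero by linarith
      have Ez: "E N ?z = exp (of_real (of_nat N * cos y))"
        by (simp add: E_def cos_of_real[symmetric] cos_exp_eq del: cos_of_real)
      \<comment> \<open>Here the rectangle of half-height \<open>pi\<close> contains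
        \<open>z\<close>, so \<open>V\<close> differs from \<open>E\<close> only by the two
        horizontal sides.\<close>
      have *: "?h1 + I N ?z (Complex X (-pi)) (Complex X pi) +
         ?h2 + I N ?z (Complex (-X) pi) (Complex (-X) (-pi)) = 2 * of_real pi * \<i> * E N ?z"
        unfolding I_def using X yp
        by (subst contour_integral_rectangle_Cauchy[OF Ehol]) (auto simp: X_def)
      define W where "W = - ?h1 - ?h2"
      have W: "V N ?z - E N ?z = W / (2 * of_real pi * \<i>)"
        using * unfolding V_def W_def by (simp add: field_simps)
      have "norm ?h1 \<le> 8*X/pi" "norm ?h2 \<le> 8*X/pi"
        using horiz[of "-1" "-pi" ?z N] horiz[of "1" "pi" ?z N] y by auto
      moreover have "norm W \<le> norm ?h1 + norm ?h2"
        unfolding W_def by norm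
      ultimately have "norm W \<le> 8*X/pi + 8*X/pi" by linarith
      also have "\<dots> \<le> 2*pi + 16*X/pi" by (simp add: field_simps)
      finally have "norm W / (2*pi) \<le> C" by (rule C)
      then show ?thesis
        unfolding Ez[symmetric] W by (simp add: norm_divide norm_mult)
    qed
  qed
qed

text \<open>Laplace's method. If \<open>D 0\<close> were nonzero, normalise so that the real part is
  1 at 0. The part near 0 then contributes at least a constant times exp (N p), and negative values
  occur only where the weight is at most exp (N q) with \<open>q < p\<close>, so the integrals would
  be unbounded.\<close>

lemma peak_integral_bounded_imp_zero:
  fixes D :: "real \<Rightarrow> complex"
  assumes "0 < a" "a \<le> pi" and cont: "continuous_on {-a..a} D"
    and bound: "\<And>N. norm (integral {-a..a} (\<lambda>y. exp (of_real (of_nat N * cos y)) * D y)) \<le> C"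
  shows "D 0 = 0"
proof (rule ccontr)
  assume D0: "D 0 \<noteq> 0"
  define F where "F = (\<lambda>y. Re (D y / D 0))"
  have Fc: "continuous_on {-a..a} F"
    unfolding F_def using D0 by (intro continuous_intros cont) auto
  have F0: "F 0 = 1" using D0 by (simp add: F_def)
  obtain d where d: "d > 0" "\<And>y. y \<in> {-a..a} \<Longrightarrow> \<bar>y\<bar> < d \<Longrightarrow> \<bar>F y - 1\<bar> < 1/2"
    using Fc[unfolded continuous_on_iff, rule_format, of 0 "1/2"] \<open>0 < a\<close> F0
    by (auto simp: dist_real_def)
  \<comment> \<open>\<open>\<eta> < d\<close> keeps \<open>F\<close> above 1/2 on |y| <
    \<open>\<eta>\<close>; \<open>\<eta> \<le> 1\<close> makes \<open>p = cos (\<eta>/2)\<close>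
    positive, so that exp (N p) really grows.\<close>
  define \<eta> where "\<eta> = min (d/2) (min a 1)"
  have eta: "0 < \<eta>" "\<eta> \<le> a" "\<eta> < d" "\<eta> \<le> 1" using d \<open>0<a\<close> by (auto simp: \<eta>_def)
  obtain B where B: "B > 0" "\<And>y. y \<in> {-a..a} \<Longrightarrow> \<bar>F y\<bar> \<le> B"
    using compact_imp_bounded[OF compact_continuous_image[OF Fc compact_Icc]]
    by (auto simp: bounded_pos)
  define p where "p = cos (\<eta>/2)"
  define q where "q = cos \<eta>"
  have "0 < p"
    unfolding p_def using eta pi_gt3 by (intro cos_gt_zero) auto
  have "q < p"
    unfolding p_def q_def using eta \<open>a \<le> pi\<close> by (intro cos_monotone_0_pi) auto
  have c_eta: "cos y = cos \<bar>y\<bar>" for y :: real by (simp add: abs_if)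
  have int: "(\<lambda>y. exp (of_nat N * cos y) * F y) integrable_on {-a..a}" for N
    by (intro integrable_continuous_real continuous_intros Fc)
  have lower: "\<eta> / 2 * exp (of_nat N * p) - 2 * a * B * exp (of_nat N * q) \<le>
      integral {-a..a} (\<lambda>y. exp (of_nat N * cos y) * F y)" for N
  proof -
    \<comment> \<open>A lower bound for the integrand: half the least weight on |y| at most
      \<open>\<eta>/2\<close>, minus a constant that pays for the uncontrolled sign of
      \<open>F\<close> beyond \<open>\<eta>\<close>. In between \<open>F\<close> is
      nonnegative.\<close>
    let ?g = "\<lambda>y. (if y \<in> {-(\<eta>/2)..\<eta>/2} then exp (of_nat N * p) / 2 else 0) - B * exp (of_nat N * q)"
    have "((\<lambda>y. if y \<in> {-(\<eta>/2)..\<eta>/2} then exp (of_nat N * p) / 2 else 0) has_integral \<eta> * (exp (of_nat N * p) / 2)) {-a..a}"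
      using has_integral_const_real[of "exp (of_nat N * p) / 2" "-(\<eta>/2)" "\<eta>/2"] eta
      by (subst has_integral_restrict) (auto simp: field_simps)
    moreover have "((\<lambda>y. B * exp (of_nat N * q)) has_integral 2 * a * (B * exp (of_nat N * q))) {-a..a}"
      using has_integral_const_real[of "B * exp (of_nat N * q)" "-a" a] \<open>0<a\<close> by (simp add: mult_ac)
    ultimately have g: "(?g has_integral \<eta> * (exp (of_nat N * p) / 2) - 2 * a * (B * exp (of_nat N * q))) {-a..a}"
      by (rule has_integral_diff)
    have "\<eta> * (exp (of_nat N * p) / 2) - 2 * a * (B * exp (of_nat N * q)) \<le>
        integral {-a..a} (\<lambda>y. exp (of_nat N * cos y) * F y)"
    proof (rule has_integral_le[OF g integrable_integral[OF int]])
      fix y assume y: "y \<in> {-a..a}"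
      have B0: "0 \<le> B * exp (of_nat N * q)" using B by simp
      consider "\<bar>y\<bar> \<le> \<eta>/2" | "\<eta>/2 < \<bar>y\<bar>" "\<bar>y\<bar> < \<eta>" | "\<eta> \<le> \<bar>y\<bar>" by linarith
      then show "?g y \<le> exp (of_nat N * cos y) * F y"
      proof cases
        case 1
        have "p \<le> cos y"
          unfolding p_def c_eta[of y] using 1 eta \<open>a \<le> pi\<close> by (intro cos_monotone_0_pi_le) auto
        then have "exp (of_nat N * p) \<le> exp (of_nat N * cos y)" by (simp add: mult_left_mono)
        moreover have "1/2 \<le> F y" using d(2)[OF y] 1 eta by (auto simp: abs_if split: if_splits)
        ultimately have "exp (of_nat N * p) * (1/2) \<le> exp (of_nat N * cos y) * F y"
          by (intro mult_mono) auto
        then show ?thesis using 1 B0 by auto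
      next
        case 2
        then have "1/2 \<le> F y" using d(2)[OF y] eta by (auto simp: abs_if split: if_splits)
        then have "0 \<le> exp (of_nat N * cos y) * F y" by auto
        then show ?thesis using 2 B0 by auto
      next
        case 3
        have "cos y \<le> q"
          unfolding q_def c_eta[of y] using 3 eta y \<open>a \<le> pi\<close> by (intro cos_monotone_0_pi_le) auto
        then have "exp (of_nat N * cos y) \<le> exp (of_nat N * q)" by (simp add: mult_left_mono)
        then have "exp (of_nat N * cos y) * \<bar>F y\<bar> \<le> exp (of_nat N * q) * B"
          using B(2)[OF y] by (intro mult_mono) auto
        then have "- (exp (of_nat N * q) * B) \<le> exp (of_nat N * cos y) * F y"
          using abs_ge_minus_self[of "exp (of_nat N * cos y) * F y"] by (simp add: abs_mult)
        then show ?thesis using 3 eta by (auto simp: mult.commute)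
      qed
    qed
    then show ?thesis by (simp add: mult_ac)
  qed
  have upper: "integral {-a..a} (\<lambda>y. exp (of_nat N * cos y) * F y) \<le> C / norm (D 0)" for N
  proof -
    have i1: "(\<lambda>y. exp (of_real (of_nat N * cos y)) * D y) integrable_on {-a..a}"
      by (intro integrable_continuous_real continuous_intros cont)
    have "((\<lambda>y. Re ((exp (of_real (of_nat N * cos y)) * D y) / D 0)) has_integral
        Re (integral {-a..a} (\<lambda>y. exp (of_real (of_nat N * cos y)) * D y) / D 0)) {-a..a}"
      by (intro has_integral_Re has_integral_divide integrable_integral i1)
    moreover have "Re ((exp (of_real (of_nat N * cos y)) * D y) / D 0) = exp (of_nat N * cos y) * F y" for y
      unfolding F_def exp_of_real[symmetric] times_divide_eq_right[symmetric]
      by (simp only: exp_of_real times_complex.sel Re_complex_of_real Im_complex_of_real mult_zero_left diff_zero)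
    ultimately have "integral {-a..a} (\<lambda>y. exp (of_nat N * cos y) * F y) =
        Re (integral {-a..a} (\<lambda>y. exp (of_real (of_nat N * cos y)) * D y) / D 0)"
      by (simp add: integral_unique)
    also have "\<dots> \<le> norm (integral {-a..a} (\<lambda>y. exp (of_real (of_nat N * cos y)) * D y) / D 0)"
      by (rule complex_Re_le_cmod)
    also have "\<dots> \<le> C / norm (D 0)"
      unfolding norm_divide using bound[of N] by (intro divide_right_mono) auto
    finally show ?thesis .
  qed
  have "eventually (\<lambda>N. C / norm (D 0) < \<eta> / 2 * exp (of_nat N * p) - 2 * a * B * exp (of_nat N * q)) sequentially"
    using \<open>0 < p\<close> \<open>q < p\<close> eta by real_asymp
  then obtain N where "C / norm (D 0) < \<eta> / 2 * exp (of_nat N * p) - 2 * a * B * exp (of_nat N * q)"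
    using eventually_sequentially by auto
  with lower[of N] upper[of N] show False by linarith
qed

section \<open>Symmetric Riemann maps\<close>

text \<open>Intermediate values of \<open>Im\<close>, which takes opposite values at
  \<open>s\<close> and \<open>cnj s\<close>.\<close>

lemma connected_symmetric_real_point:
  assumes "connected S" "S \<noteq> {}" "cnj ` S = S"
  obtains p where "p \<in> S" "Im p = 0"
proof -
  obtain s where s: "s \<in> S" using assms by auto
  have s': "cnj s \<in> S" using s assms by (metis imageI)
  have ims: "Im s \<in> Im ` S" "Im (cnj s) \<in> Im ` S" using s s' by blast+
  have conn: "connected (Im ` S)"
    using assms(1) by (intro connected_continuous_image continuous_intros)
  have "0 \<in> Im ` S"
  proof (cases "Im s \<le> 0")
    case True
    show ?thesis
      by (rule connectedD_interval[OF conn, of "Im s" "Im (cnj s)"]) (use ims True in auto)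
  next
    case False
    show ?thesis
      by (rule connectedD_interval[OF conn, of "Im (cnj s)" "Im s"]) (use ims False in auto)
  qed
  then show ?thesis using that by auto
qed

text \<open>Normalise a Riemann map to send a real point to 0. Comparing it with its conjugate gives
  a disc automorphism fixing 0, hence a rotation by some \<open>\<alpha>\<close>; rotating the map
  by a square root of \<open>\<alpha>\<close> makes it commute with conjugation.\<close>

lemma symmetric_Riemann_map:
  assumes S: "open S" "simply_connected S" "S \<noteq> {}" "S \<noteq> UNIV" "cnj ` S = S"
  obtains \<phi> \<Phi> where "\<phi> holomorphic_on ball 0 1" "\<Phi> holomorphic_on S"
    "\<And>z. z \<in> S \<Longrightarrow> \<Phi> z \<in> ball 0 1" "\<And>z. z \<in> S \<Longrightarrow> \<phi> (\<Phi> z) = z"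
    "\<And>\<zeta>. \<zeta> \<in> ball 0 1 \<Longrightarrow> \<phi> \<zeta> \<in> S" "\<And>\<zeta>. \<zeta> \<in> ball 0 1 \<Longrightarrow> \<Phi> (\<phi> \<zeta>) = \<zeta>"
    "\<And>\<zeta>. \<zeta> \<in> ball 0 1 \<Longrightarrow> \<phi> (cnj \<zeta>) = cnj (\<phi> \<zeta>)"
proof -
  have cnjS: "cnj z \<in> S" if "z \<in> S" for z using that S(5) by (metis imageI)
  obtain p where p: "p \<in> S" "Im p = 0"
    using connected_symmetric_real_point[of S] S simply_connected_imp_connected by metis
  then have cp: "cnj p = p" by (simp add: complex_eq_iff)
  obtain f g where fg: "f holomorphic_on S" "g holomorphic_on ball 0 1"
     "\<And>z. z \<in> S \<Longrightarrow> f z \<in> ball 0 1 \<and> g (f z) = z" "\<And>z. z \<in> ball 0 1 \<Longrightarrow> g z \<in> S \<and> f (g z) = z"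
    using simply_connected_eq_biholomorphic_to_disc[OF S(1)] S by metis
  \<comment> \<open>A disc automorphism moving the image of the real point \<open>p\<close> to the
    centre.\<close>
  obtain h k where hk: "h (f p) = 0"
       "h holomorphic_on ball 0 1" "h ` ball 0 1 \<subseteq> ball 0 1"
       "k holomorphic_on ball 0 1" "k ` ball 0 1 \<subseteq> ball 0 1"
       "\<And>z. z \<in> ball 0 1 \<Longrightarrow> h (k z) = z" "\<And>z. z \<in> ball 0 1 \<Longrightarrow> k (h z) = z"
    using ball_biholomorphism_exists[of "f p"] fg(3)[OF p(1)] by metis
  define F where "F = h \<circ> f"
  define G where "G = g \<circ> k"
  have kball: "k z \<in> ball 0 1" if "z \<in> ball 0 1" for z using hk(5) that by blast
  have hball: "h z \<in> ball 0 1" if "z \<in> ball 0 1" for z using hk(3) that by blast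
  have F: "F holomorphic_on S"
    unfolding F_def using fg hk by (intro holomorphic_on_compose) (auto intro: holomorphic_on_subset)
  have G: "G holomorphic_on ball 0 1"
    unfolding G_def using fg hk by (intro holomorphic_on_compose) (auto intro: holomorphic_on_subset)
  have FS: "F z \<in> ball 0 1" "G (F z) = z" if "z \<in> S" for z
    using fg(3)[OF that] hball hk(7) by (auto simp: F_def G_def)
  have GS: "G z \<in> S" "F (G z) = z" if "z \<in> ball 0 1" for z
    using kball[OF that] fg(4) hk(6)[OF that] by (auto simp: F_def G_def)
  have F0: "F p = 0" using hk(1) by (simp add: F_def)
  have G0: "G 0 = p" using FS(2)[OF p(1)] F0 by simp
  have imcnj: "cnj ` ball 0 1 = ball 0 1"
    by (auto simp: image_iff intro!: bexI[of _ "cnj _"])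
  \<comment> \<open>\<open>u\<close> compares \<open>F\<close> with the conjugated inverse map; it
    fixes 0 because \<open>p\<close> is real, and \<open>u_inv\<close> shows that its own conjugate
    inverts it.\<close>
  define u where "u = F \<circ> (cnj \<circ> G \<circ> cnj)"
  have u_hol: "u holomorphic_on ball 0 1"
    unfolding u_def
  proof (rule holomorphic_on_compose)
    show "cnj \<circ> G \<circ> cnj holomorphic_on ball 0 1"
      using G by (intro holomorphic_on_compose_cnj_cnj) (auto simp: imcnj)
    show "F holomorphic_on (cnj \<circ> G \<circ> cnj) ` ball 0 1"
      by (rule holomorphic_on_subset[OF F]) (auto intro!: cnjS GS)
  qed
  have u0: "u 0 = 0" by (simp add: u_def G0 cp F0)
  have u_ball: "norm (u z) < 1" if "norm z < 1" for z
    using FS(1)[OF cnjS[OF GS(1)], of "cnj z"] that by (simp add: u_def)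
  have u_inv: "u (cnj (u (cnj z))) = z" if "norm z < 1" for z
    using that FS(2)[OF cnjS[OF GS(1)], of z] GS(2)[of z] by (simp add: u_def)
  \<comment> \<open>The Schwarz inequality at \<open>1/2\<close>, and again at
    \<open>cnj (u (1/2))\<close>, which \<open>u\<close> sends back to \<open>1/2\<close>. Equality
    at one nonzero point forces a rotation.\<close>
  have "norm (u (1/2)) = norm (1/2 :: complex)"
  proof (rule antisym)
    show "norm (u (1/2)) \<le> norm (1/2 :: complex)"
      by (rule Schwarz_Lemma(1)[OF u_hol u0 u_ball]) (auto simp: norm_divide)
    have "norm (u (cnj (u (1/2)))) \<le> norm (cnj (u (1/2)))"
      by (rule Schwarz_Lemma(1)[OF u_hol u0 u_ball]) (auto intro: u_ball simp: norm_divide)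
    moreover have "u (cnj (u (1/2))) = 1/2" using u_inv[of "1/2"] by (simp add: norm_divide)
    ultimately show "norm (1/2 :: complex) \<le> norm (u (1/2))" by simp
  qed
  then obtain \<alpha> where \<alpha>: "\<And>z. norm z < 1 \<Longrightarrow> u z = \<alpha> * z" "norm \<alpha> = 1"
  proof -
    have "\<exists>z. norm z < 1 \<and> z \<noteq> 0 \<and> norm (u z) = norm z"
      using \<open>norm (u (1/2)) = norm (1/2 :: complex)\<close>
      by (intro exI[of _ "1/2"]) (simp add: norm_divide)
    then have "\<exists>\<alpha>. (\<forall>z. norm z < 1 \<longrightarrow> u z = \<alpha> * z) \<and> norm \<alpha> = 1"
      using Schwarz_Lemma'[OF u_hol u0 u_ball] by blast
    then show ?thesis using that by blast
  qed
  define \<beta> where "\<beta> = csqrt \<alpha>"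
  have \<beta>: "\<beta> * \<beta> = \<alpha>" "norm \<beta> = 1"
    using \<alpha>(2) by (simp_all add: \<beta>_def power2_eq_square[symmetric])
  have bb: "cnj \<beta> * \<beta> = 1" "\<beta> \<noteq> 0"
    using \<beta>(2) by (auto simp: mult.commute complex_norm_square[symmetric])
  have refl: "G (\<alpha> * z) = cnj (G (cnj z))" if "norm z < 1" for z
    using FS(2)[OF cnjS[OF GS(1)], of "cnj z"] \<alpha>(1)[OF that] that by (simp add: u_def)
  have mb: "\<beta> * z \<in> ball 0 1 \<longleftrightarrow> z \<in> ball 0 1" "z / \<beta> \<in> ball 0 1 \<longleftrightarrow> z \<in> ball 0 1" for z
    using \<beta>(2) by (auto simp: norm_mult norm_divide)
  show thesis
  proof
    show "(\<lambda>z. G (\<beta> * z)) holomorphic_on ball 0 1"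
      using holomorphic_on_compose_gen[OF _ G, of "\<lambda>z. \<beta> * z" "ball 0 1"] mb(1)
      by (auto simp: o_def image_subset_iff intro!: holomorphic_intros)
    show "(\<lambda>z. F z / \<beta>) holomorphic_on S"
      using bb by (intro holomorphic_intros F)
    show "F z / \<beta> \<in> ball 0 1" "G (\<beta> * (F z / \<beta>)) = z" if "z \<in> S" for z
      using FS[OF that] mb(2)[of "F z"] bb by auto
    show "G (\<beta> * z) \<in> S" "F (G (\<beta> * z)) / \<beta> = z" if "z \<in> ball 0 1" for z
      using GS[of "\<beta> * z"] that mb(1)[of z] bb by auto
    show "G (\<beta> * cnj z) = cnj (G (\<beta> * z))" if "z \<in> ball 0 1" for z
    proof -
      have "norm (cnj \<beta> * cnj z) < 1" using that \<beta> by (simp add: norm_mult)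
      from refl[OF this] have "G (\<alpha> * (cnj \<beta> * cnj z)) = cnj (G (\<beta> * z))" by simp
      moreover have "\<alpha> * (cnj \<beta> * cnj z) = \<beta> * cnj z"
        using bb by (simp add: \<beta>(1)[symmetric] mult_ac) 
      ultimately show ?thesis by simp
    qed
  qed
qed

section \<open>A Cauchy kernel odd under conjugation\<close>

text \<open>
  On the circle \<open>|u| = R\<close> the term \<open>q / (q - cnj u)\<close> equals \<open>q u / (q u - R\<^sup>2)\<close>, which is holomorphic in the
  disc for \<open>|q| < R\<close>; adding it makes the Cauchy kernel of \<open>q1\<close> minus that of \<open>q2\<close> odd under conjugation.
\<close>

lemma Cauchy_circle_odd_kernel:
  assumes h: "h holomorphic_on ball 0 1" and R: "0 < R" "R < 1"
    and q: "norm q1 < R" "norm q2 < R"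
  defines "c \<equiv> circlepath 0 R"
  defines "\<kappa> \<equiv> \<lambda>x. c x / (c x - q1) + q1 / (q1 - cnj (c x)) - c x / (c x - q2) - q2 / (q2 - cnj (c x))"
  shows "((\<lambda>x. h (c x) * \<kappa> x) has_integral (h q1 - h q2)) {0..1}"
proof -
  have hol: "h holomorphic_on cball 0 R" using R by (intro holomorphic_on_subset[OF h]) auto
  have ne: "q * u \<noteq> of_real (R^2)" if "norm q < R" "norm u \<le> R" for q u :: complex
  proof
    assume "q * u = of_real (R^2)"
    then have "norm q * norm u = R^2" using R by (metis norm_mult norm_of_real abs_power2)
    moreover have "norm q * norm u < R * R"
      using that R mult_le_less_imp_less[of "norm u" R "norm q" R] by (cases "u = 0") (auto simp: mult.commute)
    ultimately show False by (simp add: power2_eq_square)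
  qed
  \<comment> \<open>The correction that makes the kernel odd, in its holomorphic form: it is regular
    on the closed disc by \<open>ne\<close>, so it adds nothing to the Cauchy integral.\<close>
  define g where "g = (\<lambda>u. h u * (q1 / (q1 * u - of_real (R^2)) - q2 / (q2 * u - of_real (R^2))))"
  have g: "g holomorphic_on cball 0 R"
    unfolding g_def using ne q by (intro holomorphic_intros hol) auto
  have 1: "((\<lambda>u. h u / (u - q1)) has_contour_integral (2 * of_real pi * \<i> * h q1)) c"
    "((\<lambda>u. h u / (u - q2)) has_contour_integral (2 * of_real pi * \<i> * h q2)) c"
    unfolding c_def using q by (auto intro!: Cauchy_integral_circlepath_simple hol)
  have 2: "(g has_contour_integral 0) c"
    unfolding c_def using R by (intro Cauchy_theorem_convex_simple[OF g]) auto
  have "((\<lambda>u. h u / (u - q1) - h u / (u - q2) + g u) has_contour_integral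
      (2 * of_real pi * \<i> * h q1 - 2 * of_real pi * \<i> * h q2 + 0)) c"
    by (intro has_contour_integral_add has_contour_integral_diff 1 2)
  then have "((\<lambda>x. (h (c x) / (c x - q1) - h (c x) / (c x - q2) + g (c x)) * vector_derivative c (at x)) has_integral
      (2 * of_real pi * \<i> * h q1 - 2 * of_real pi * \<i> * h q2)) {0..1}"
    unfolding has_contour_integral by simp
  then have 3: "((\<lambda>x. (h (c x) / (c x - q1) - h (c x) / (c x - q2) + g (c x)) * vector_derivative c (at x) / (2 * of_real pi * \<i>)) has_integral
      (2 * of_real pi * \<i> * h q1 - 2 * of_real pi * \<i> * h q2) / (2 * of_real pi * \<i>)) {0..1}"
    by (rule has_integral_divide)
  \<comment> \<open>Since c' = 2 pi i c, dividing by 2 pi i turns the contour integrals into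
    ordinary integrals over the parameter with factors \<open>c x / (c x - q)\<close>.\<close>
  have eq: "(h (c x) / (c x - q1) - h (c x) / (c x - q2) + g (c x)) * vector_derivative c (at x) / (2 * of_real pi * \<i>) =
      h (c x) * \<kappa> x" for x
  proof -
    have vd: "vector_derivative c (at x) = 2 * of_real pi * \<i> * c x"
      unfolding c_def vector_derivative_circlepath by (simp add: circlepath)
    have nc: "norm (c x) = R" using R by (simp add: c_def circlepath norm_mult)
    then have c0: "c x \<noteq> 0" using R by auto
    have sq: "of_real (R^2) = c x * cnj (c x)"
      using nc by (metis complex_norm_square)
    have k: "q / (q * c x - of_real (R^2)) * c x = q / (q - cnj (c x))" for q
      unfolding sq using c0 by (simp add: field_simps) (metis mult.commute right_diff_distrib' mult_divide_mult_cancel_right divide_divide_eq_left times_divide_eq_right)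
    have "(h (c x) / (c x - q1) - h (c x) / (c x - q2) + g (c x)) * vector_derivative c (at x) / (2 * of_real pi * \<i>)
       = h (c x) * (c x / (c x - q1) - c x / (c x - q2) + (q1 / (q1 * c x - of_real (R^2)) * c x - q2 / (q2 * c x - of_real (R^2)) * c x))"
      unfolding vd g_def by (simp add: field_simps)
    then show ?thesis unfolding k \<kappa>_def by (simp add: algebra_simps)
  qed
  have "(2 * of_real pi * \<i> * h q1 - 2 * of_real pi * \<i> * h q2) / (2 * of_real pi * \<i>) = h q1 - h q2"
    by (simp add: right_diff_distrib[symmetric] diff_divide_distrib)
  with 3 show ?thesis unfolding eq by simp
qed

section \<open>Integrals over reflected windows and intervals\<close>

text \<open>The two windows are mirror images; apart from their common part they consist of two end
  pieces of length 2 |\<open>\<sigma>\<close>|, both at heights between \<open>r - m\<close> and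
  \<open>r + m\<close>. This is the cancellation between the points \<open>s\<close> and
  \<open>cnj s\<close>.\<close>

lemma norm_integral_window_diff_le:
  fixes p :: "real \<Rightarrow> complex"
  assumes p: "continuous_on {-(r+m)..r+m} p" and s: "\<bar>\<sigma>\<bar> \<le> m" "m < r"
    and k: "\<And>y. r - m \<le> \<bar>y\<bar> \<Longrightarrow> \<bar>y\<bar> \<le> r + m \<Longrightarrow> norm (p y) \<le> k"
  shows "norm (integral {\<sigma>-r..\<sigma>+r} p - integral {-\<sigma>-r..-\<sigma>+r} p) \<le> 4 * m * k"
proof -
  have k0: "0 \<le> k" using k[of r] s by (smt (verit) norm_ge_zero)
  have main: "norm (integral {\<sigma>-r..\<sigma>+r} p - integral {-\<sigma>-r..-\<sigma>+r} p) \<le> 4 * m * k"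
    if "0 \<le> \<sigma>" "\<sigma> \<le> m" for \<sigma>
  proof -
    have sub: "continuous_on {a..b} p" if "-(r+m) \<le> a" "b \<le> r+m" for a b
      using that by (intro continuous_on_subset[OF p]) auto
    have int: "p integrable_on {a..b}" if "-(r+m) \<le> a" "b \<le> r+m" for a b
      using that by (intro integrable_continuous_real sub)
    have 1: "integral {\<sigma>-r..\<sigma>+r} p = integral {\<sigma>-r..r-\<sigma>} p + integral {r-\<sigma>..\<sigma>+r} p"
      using that s by (intro Henstock_Kurzweil_Integration.integral_combine[symmetric] int) auto
    have 2: "integral {-\<sigma>-r..-\<sigma>+r} p = integral {-\<sigma>-r..\<sigma>-r} p + integral {\<sigma>-r..-\<sigma>+r} p"
      using that s by (intro Henstock_Kurzweil_Integration.integral_combine[symmetric] int) auto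
    have "norm (integral {r-\<sigma>..\<sigma>+r} p) \<le> k * ((\<sigma>+r) - (r-\<sigma>))"
      using that s by (intro integral_bound sub k) auto
    moreover have "norm (integral {-\<sigma>-r..\<sigma>-r} p) \<le> k * ((\<sigma>-r) - (-\<sigma>-r))"
      using that s by (intro integral_bound sub k) auto
    ultimately have "norm (integral {r-\<sigma>..\<sigma>+r} p - integral {-\<sigma>-r..\<sigma>-r} p) \<le> k * (2*\<sigma>) + k * (2*\<sigma>)"
      using norm_triangle_ineq4[of "integral {r-\<sigma>..\<sigma>+r} p" "integral {-\<sigma>-r..\<sigma>-r} p"] by (simp add: algebra_simps)
    moreover have "integral {\<sigma>-r..\<sigma>+r} p - integral {-\<sigma>-r..-\<sigma>+r} p =
        integral {r-\<sigma>..\<sigma>+r} p - integral {-\<sigma>-r..\<sigma>-r} p"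
      unfolding 1 2 by (simp add: algebra_simps)
    ultimately have "norm (integral {\<sigma>-r..\<sigma>+r} p - integral {-\<sigma>-r..-\<sigma>+r} p) \<le> k * (2*\<sigma>) + k * (2*\<sigma>)"
      by simp
    also have "\<dots> \<le> 4 * m * k" using mult_left_mono[OF that(2) k0] by (simp add: algebra_simps)
    finally show ?thesis .
  qed
  show ?thesis
  proof (cases "0 \<le> \<sigma>")
    case True then show ?thesis using main s by auto
  next
    case False
    then show ?thesis using main[of "-\<sigma>"] s by (simp add: norm_minus_commute)
  qed
qed

lemma integral_reflect_unit_interval:
  fixes f :: "real \<Rightarrow> 'a::euclidean_space"
  shows "integral {0..1} (\<lambda>x. f (1 - x)) = integral {0..1} f"
proof -
  have "integral {0..1} ((\<lambda>x. f (- x)) \<circ> ((+) (-1))) = integral {-1..0} (\<lambda>x. f (- x))"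
    by (subst integral_shift_Icc_real) simp
  also have "\<dots> = integral {0..1} f"
    using Henstock_Kurzweil_Integration.integral_reflect_real[of 1 0 f] by simp
  finally show ?thesis by (simp add: o_def)
qed

section \<open>Comparison of the extensions\<close>

text \<open>The data are pulled back to the fixed domain, and \<open>F\<close> is a continuous
  extension of \<open>f\<close> to the plane, so that all heights can be compared on one product
  set. By \<open>height_sharp\<close>, \<open>m\<close> is the exact half-height, which
  \<open>exists_low_translate\<close> relies on.\<close>

locale translated_family =
  fixes \<Omega> :: "complex set" and r m :: real and F :: "complex \<Rightarrow> complex" and G :: "complex \<Rightarrow> real \<Rightarrow> complex"
  assumes open_dom: "open \<Omega>" and bounded_dom: "bounded \<Omega>" and nonempty_dom: "\<Omega> \<noteq> {}"
    and simply_connected_dom: "simply_connected \<Omega>" and cnj_dom: "cnj ` \<Omega> = \<Omega>"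
    and height: "\<And>s. s \<in> \<Omega> \<Longrightarrow> \<bar>Im s\<bar> \<le> m" and m_less: "m < r"
    and height_sharp: "\<exists>s\<in>closure \<Omega>. Im s = m"
    and F_cont: "continuous_on UNIV F"
    and G_cont: "continuous_on (closure \<Omega> \<times> {-r..r}) (\<lambda>(s, t). G s t)"
    and G_hol: "\<And>t. t \<in> {-r..r} \<Longrightarrow> (\<lambda>s. G s t) holomorphic_on \<Omega>"
    and G_eq: "\<And>s t. s \<in> frontier \<Omega> \<Longrightarrow> t \<in> {-r..r} \<Longrightarrow> G s t = F (s + \<i> * of_real t)"
begin

lemma r_pos: "0 < r" and m_nonneg: "0 \<le> m"
  using height m_less nonempty_dom by (fastforce)+

lemma compact_closure_dom: "compact (closure \<Omega>)"
  using bounded_dom by simp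

lemma cnj_in_dom: "s \<in> \<Omega> \<Longrightarrow> cnj s \<in> \<Omega>"
  using cnj_dom by (metis imageI)

text \<open>The pairs where \<open>G\<close> and \<open>F\<close> differ by at least
  \<open>e\<close> form a compact set, and their points \<open>s\<close> avoid the frontier, where
  the two agree. The image of these points in the disc is compact, so it stays in a smaller disc.
  This stands in for boundary values of the Riemann map.\<close>

lemma G_near_boundary:
  assumes \<Phi>: "\<Phi> holomorphic_on \<Omega>" "\<And>z. z \<in> \<Omega> \<Longrightarrow> \<Phi> z \<in> ball 0 1" and e: "0 < e"
  obtains R where "R < 1"
    "\<And>s t. s \<in> \<Omega> \<Longrightarrow> R < norm (\<Phi> s) \<Longrightarrow> t \<in> {-r..r} \<Longrightarrow> norm (G s t - F (s + \<i> * of_real t)) < e"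
proof -
  define d where "d = (\<lambda>(s, t). norm (G s t - F (s + \<i> * of_real t)))"
  define K where "K = {p \<in> closure \<Omega> \<times> {-r..r}. e \<le> d p}"
  have d: "continuous_on (closure \<Omega> \<times> {-r..r}) d"
    using G_cont unfolding d_def case_prod_unfold
    by (intro continuous_intros continuous_on_compose2[OF F_cont]) (auto intro!: continuous_intros)
  have "compact (closure \<Omega> \<times> {-r..r})"
    using compact_closure_dom by (intro compact_Times) auto
  then have "compact K"
  proof (rule closedin_compact)
    have "K = (closure \<Omega> \<times> {-r..r}) \<inter> d -` {e..}" by (auto simp: K_def)
    then show "closedin (top_of_set (closure \<Omega> \<times> {-r..r})) K"
      using continuous_closedin_preimage[OF d, of "{e..}"] by simp
  qed
  then have cK: "compact (fst ` K)"
    by (intro compact_continuous_image continuous_intros)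
  have sub: "fst ` K \<subseteq> \<Omega>"
  proof
    fix s assume "s \<in> fst ` K"
    then obtain t where st: "s \<in> closure \<Omega>" "t \<in> {-r..r}" "e \<le> norm (G s t - F (s + \<i> * of_real t))"
      by (auto simp: K_def d_def)
    then have "s \<notin> frontier \<Omega>" using G_eq e by auto
    with st show "s \<in> \<Omega>" using open_dom by (auto simp: frontier_def interior_open)
  qed
  have im: "compact (\<Phi> ` fst ` K)"
    using \<Phi> sub by (intro compact_continuous_image cK holomorphic_on_imp_continuous_on) (auto intro: holomorphic_on_subset)
  have "\<exists>R<1. \<forall>w\<in>\<Phi> ` fst ` K. norm w \<le> R"
  proof (cases "K = {}")
    case True then show ?thesis by (auto intro: exI[of _ 0])
  next
    case False
    then obtain w where w: "w \<in> \<Phi> ` fst ` K" "\<forall>v\<in>\<Phi> ` fst ` K. norm v \<le> norm w"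
      using continuous_attains_sup[OF im, of norm] by (auto intro: continuous_intros)
    moreover have "norm w < 1" using w(1) sub \<Phi>(2) by fastforce
    ultimately show ?thesis by blast
  qed
  then obtain R where R: "R < 1" "\<And>w. w \<in> \<Phi> ` fst ` K \<Longrightarrow> norm w \<le> R" by blast
  show thesis
  proof (rule that[OF R(1)])
    fix s t assume st: "s \<in> \<Omega>" "R < norm (\<Phi> s)" "t \<in> {-r..r}"
    show "norm (G s t - F (s + \<i> * of_real t)) < e"
    proof (rule ccontr)
      assume "\<not> ?thesis"
      then have "(s, t) \<in> K" using st closure_subset by (auto simp: K_def d_def)
      then have "\<Phi> s \<in> \<Phi> ` fst ` K" by force
      with R(2) st show False by force
    qed
  qed
qed

text \<open>Cauchy's formula with the odd kernel on a circle near the unit circle, integrated over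
  \<open>t\<close>. Oddness leaves only differences between \<open>s\<close> and
  \<open>cnj s\<close>; near the boundary these are window differences of one function on one
  vertical line, which see \<open>V\<close> only at heights |y| at least
  \<open>r - m\<close>.\<close>

lemma test_function_estimate:
  assumes s12: "s1 \<in> \<Omega>" "s2 \<in> \<Omega>"
    and T: "open T" "\<And>s y. s \<in> closure \<Omega> \<Longrightarrow> Complex (Re s) y \<in> T"
  obtains C where
    "\<And>V c. V holomorphic_on T \<Longrightarrow>
      (\<And>s y. s \<in> \<Omega> \<Longrightarrow> r - m \<le> \<bar>y\<bar> \<Longrightarrow> norm (V (Complex (Re s) y)) \<le> c) \<Longrightarrow>
      norm (integral {-r..r} (\<lambda>t. V (s1 + \<i> * of_real t) * G s1 t - V (s2 + \<i> * of_real t) * G s2 t)) \<le> C * c"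
proof -
  have "\<Omega> \<noteq> UNIV" using bounded_dom not_bounded_UNIV by blast
  then obtain \<phi> \<Phi> where \<phi>: "\<phi> holomorphic_on ball 0 1" and \<Phi>: "\<Phi> holomorphic_on \<Omega>"
    and \<Phi>b: "\<And>z. z \<in> \<Omega> \<Longrightarrow> \<Phi> z \<in> ball 0 1" and inv1: "\<And>z. z \<in> \<Omega> \<Longrightarrow> \<phi> (\<Phi> z) = z"
    and \<phi>b: "\<And>\<zeta>. \<zeta> \<in> ball 0 1 \<Longrightarrow> \<phi> \<zeta> \<in> \<Omega>" and inv2: "\<And>\<zeta>. \<zeta> \<in> ball 0 1 \<Longrightarrow> \<Phi> (\<phi> \<zeta>) = \<zeta>"
    and \<phi>c: "\<And>\<zeta>. \<zeta> \<in> ball 0 1 \<Longrightarrow> \<phi> (cnj \<zeta>) = cnj (\<phi> \<zeta>)"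
    by (rule symmetric_Riemann_map[OF open_dom simply_connected_dom nonempty_dom _ cnj_dom]) blast
  define q1 where "q1 = \<Phi> s1"
  define q2 where "q2 = \<Phi> s2"
  define \<rho> where "\<rho> = max (norm q1) (norm q2)"
  have \<rho>: "\<rho> < 1" "norm q1 \<le> \<rho>" "norm q2 \<le> \<rho>" "0 \<le> \<rho>"
    using \<Phi>b[OF s12(1)] \<Phi>b[OF s12(2)] by (auto simp: q1_def q2_def \<rho>_def le_max_iff_disj)
  \<comment> \<open>The circles used below have radius above \<open>\<rho> + \<delta>\<close>, so
    each of the four kernel terms is at most \<open>1 / \<delta>\<close>.\<close>
  define \<delta> where "\<delta> = (1 - \<rho>) / 2"
  have \<delta>: "0 < \<delta>" using \<rho> by (simp add: \<delta>_def)
  \<comment> \<open>A compact set containing all translates \<open>s + \<i> * of_real t\<close>. The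
    bound \<open>BF\<close> of \<open>F\<close> on it is fixed before \<open>V\<close>, which makes
    the final constant independent of \<open>V\<close>.\<close>
  define strip where "strip = (\<lambda>(s, y). Complex (Re s) y) ` (closure \<Omega> \<times> {-(r+m)..r+m})"
  have cont_Complex: "continuous_on A (\<lambda>(s :: complex, y). Complex (Re s) y)" for A
    unfolding case_prod_unfold Complex_eq by (intro continuous_intros)
  have strip: "compact strip" "strip \<subseteq> T"
    unfolding strip_def using compact_closure_dom T(2)
    by (auto intro!: compact_continuous_image cont_Complex compact_Times)
  obtain BF where BF: "0 < BF" "\<And>z. z \<in> strip \<Longrightarrow> norm (F z) \<le> BF"
    using compact_imp_bounded[OF compact_continuous_image[OF continuous_on_subset[OF F_cont] strip(1)]]
    by (auto simp: bounded_pos)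
  have in_strip: "s + \<i> * of_real t \<in> strip" if "s \<in> \<Omega>" "t \<in> {-r..r}" for s t
  proof -
    have "s + \<i> * of_real t = Complex (Re s) (Im s + t)" by (simp add: complex_eq_iff)
    moreover have "Im s + t \<in> {-(r+m)..r+m}" using height[OF that(1)] that(2) by auto
    ultimately show ?thesis
      using that closure_subset unfolding strip_def by (auto intro!: image_eqI[of _ _ "(s, Im s + t)"])
  qed
  have "norm (integral {-r..r} (\<lambda>t. V (s1 + \<i> * of_real t) * G s1 t - V (s2 + \<i> * of_real t) * G s2 t)) \<le> 8 / \<delta> * m * BF * c"
    (is "norm ?E \<le> _")
    if V: "V holomorphic_on T" and c: "\<And>s y. s \<in> \<Omega> \<Longrightarrow> r - m \<le> \<bar>y\<bar> \<Longrightarrow> norm (V (Complex (Re s) y)) \<le> c" for V c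
  proof -
    have c0: "0 \<le> c" using c[OF s12(1), of r] m_nonneg r_pos by (smt (verit) norm_ge_zero)
    have Vc: "continuous_on T V" by (rule holomorphic_on_imp_continuous_on[OF V])
    obtain BV where BV: "0 < BV" "\<And>z. z \<in> strip \<Longrightarrow> norm (V z) \<le> BV"
      using compact_imp_bounded[OF compact_continuous_image[OF continuous_on_subset[OF Vc strip(2)] strip(1)]]
      by (auto simp: bounded_pos)
    \<comment> \<open>\<open>s\<close> and \<open>cnj s\<close> have the same real part, so both
      integrals are integrals of \<open>p\<close>, over windows centred at \<open>Im s\<close> and
      \<open>- Im s\<close>.\<close>
    have Mdiff: "norm (integral {-r..r} (\<lambda>t. V (s + \<i> * of_real t) * F (s + \<i> * of_real t)) -
          integral {-r..r} (\<lambda>t. V (cnj s + \<i> * of_real t) * F (cnj s + \<i> * of_real t))) \<le> 4 * m * (c * BF)"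
      if s: "s \<in> \<Omega>" for s
    proof -
      define p where "p = (\<lambda>y. V (Complex (Re s) y) * F (Complex (Re s) y))"
      have inT: "Complex (Re s) y \<in> T" for y using T(2) s closure_subset by blast
      have "continuous_on A (\<lambda>y. Complex (Re s) y)" for A
        unfolding Complex_eq by (intro continuous_intros)
      then have pc: "continuous_on A p" for A
        unfolding p_def using inT
        by (intro continuous_intros continuous_on_compose2[OF Vc] continuous_on_compose2[OF F_cont]) auto
      have shift: "integral {-r..r} (\<lambda>t. V (u + \<i> * of_real t) * F (u + \<i> * of_real t)) = integral {Im u - r..Im u + r} p"
        if "Re u = Re s" for u
      proof -
        have "(\<lambda>t. V (u + \<i> * of_real t) * F (u + \<i> * of_real t)) = p \<circ> (+) (Im u)"
        proof
          fix t
          have "u + \<i> * of_real t = Complex (Re s) (Im u + t)" using that by (simp add: complex_eq_iff)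
          then show "V (u + \<i> * of_real t) * F (u + \<i> * of_real t) = (p \<circ> (+) (Im u)) t" by (simp add: p_def)
        qed
        then show ?thesis by (simp add: integral_shift_Icc_real add.commute)
      qed
      have "norm (integral {Im s - r..Im s + r} p - integral {- Im s - r..- Im s + r} p) \<le> 4 * m * (c * BF)"
      proof (rule norm_integral_window_diff_le[OF pc height[OF s] m_less])
        fix y assume y: "r - m \<le> \<bar>y\<bar>" "\<bar>y\<bar> \<le> r + m"
        then have "Complex (Re s) y \<in> strip"
          unfolding strip_def using s closure_subset by (auto intro!: image_eqI[of _ _ "(s, y)"])
        then show "norm (p y) \<le> c * BF"
          unfolding p_def norm_mult using BF c[OF s y(1)] c0 by (intro mult_mono) auto
      qed
      then show ?thesis using shift[of s] shift[of "cnj s"] by simp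
    qed
    \<comment> \<open>Here \<open>e\<close> is the cost of replacing \<open>G\<close> by
      \<open>F\<close> on the circle. The factor \<open>BV\<close> depends on \<open>V\<close>,
      which is harmless because \<open>e\<close> tends to 0 with \<open>V\<close> fixed.\<close>
    have est: "norm ?E \<le> 8 / \<delta> * m * BF * c + e * (8 / \<delta> * r * BV)" if "0 < e" for e
    proof -
      obtain R0 where R0: "R0 < 1"
        "\<And>s t. s \<in> \<Omega> \<Longrightarrow> R0 < norm (\<Phi> s) \<Longrightarrow> t \<in> {-r..r} \<Longrightarrow> norm (G s t - F (s + \<i> * of_real t)) < e"
        using G_near_boundary[OF \<Phi> \<Phi>b \<open>0 < e\<close>] by blast
      define R where "R = (max R0 (\<rho> + \<delta>) + 1) / 2"
      have R: "R0 < R" "\<rho> + \<delta> < R" "R < 1" "0 < R"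
        using R0(1) \<rho> by (auto simp: R_def \<delta>_def field_simps max_def split: if_splits)
      define cp where "cp = circlepath 0 R"
      have ncp: "norm (cp x) = R" for x using R by (simp add: cp_def circlepath norm_mult)
      have cpb: "cp x \<in> ball 0 1" for x using R ncp[of x] by simp
      have cpc: "continuous_on A cp" for A unfolding cp_def circlepath by (intro continuous_intros)
      \<comment> \<open>Reversing the parameter of the circle is conjugation, so oddness becomes
        antisymmetry under the reflection of \<open>{0..1}\<close>.\<close>
      have cpcnj: "cp (1 - x) = cnj (cp x)" for x
      proof -
        have "exp (2 * of_real pi * \<i> * of_real (1 - x)) = exp (2 * of_real pi * \<i> + - (2 * of_real pi * \<i> * of_real x))"
          by (simp add: algebra_simps)
        also have "\<dots> = exp (- (2 * of_real pi * \<i> * of_real x))"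
          unfolding exp_add by simp
        finally show ?thesis unfolding cp_def circlepath by (simp add: exp_cnj)
      qed
      define \<kappa> where "\<kappa> = (\<lambda>x. cp x / (cp x - q1) + q1 / (q1 - cnj (cp x)) - cp x / (cp x - q2) - q2 / (q2 - cnj (cp x)))"
      have dist: "\<delta> \<le> norm (u - q)" "\<delta> \<le> norm (q - u)" if "norm u = R" "norm q \<le> \<rho>" for u q
        using norm_triangle_ineq2[of u q] that R \<delta> by (auto simp: norm_minus_commute)
      have nz: "cp x - q \<noteq> 0" "q - cnj (cp x) \<noteq> 0" "cnj (cp x) - q \<noteq> 0" if "norm q \<le> \<rho>" for q x
        using ncp[of x] that R \<delta> by (auto simp del: complex_mod_cnj simp: complex_mod_cnj[of "cp x", symmetric])
      have frac: "norm (a / b) \<le> 1 / \<delta>" if "norm a \<le> 1" "\<delta> \<le> norm b" for a b :: complex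
        unfolding norm_divide using that \<delta> by (intro frac_le) auto
      have \<kappa>b: "norm (\<kappa> x) \<le> 4 / \<delta>" for x
      proof -
        have "norm (cp x / (cp x - q1)) \<le> 1/\<delta>" "norm (q1 / (q1 - cnj (cp x))) \<le> 1/\<delta>"
          "norm (cp x / (cp x - q2)) \<le> 1/\<delta>" "norm (q2 / (q2 - cnj (cp x))) \<le> 1/\<delta>"
          using \<rho> R(3) ncp[of x] dist(1)[of "cp x"] dist(2)[of "cnj (cp x)"]
          by (simp_all add: frac)
        moreover have "norm (a + b - c - d) \<le> norm a + norm b + norm c + norm d" for a b c d :: complex
          by norm
        then have "norm (\<kappa> x) \<le> norm (cp x / (cp x - q1)) + norm (q1 / (q1 - cnj (cp x))) +
            norm (cp x / (cp x - q2)) + norm (q2 / (q2 - cnj (cp x)))"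
          unfolding \<kappa>_def .
        ultimately have "norm (\<kappa> x) \<le> 1/\<delta> + 1/\<delta> + 1/\<delta> + 1/\<delta>" by linarith
        then show ?thesis by simp
      qed
      have \<kappa>odd: "\<kappa> (1 - x) = - \<kappa> x" for x
      proof -
        \<comment> \<open>For a single \<open>q\<close> the kernel and its reflection add up to the
          constant 2; only the difference of the kernels of \<open>q1\<close> and \<open>q2\<close>
          is odd, which is why two points are compared.\<close>
        have *: "u / (u - q) + q / (q - v) + (v / (v - q) + q / (q - u)) = 2" if "u - q \<noteq> 0" "v - q \<noteq> 0" for u v q :: complex
        proof -
          have "q / (q - v) = - (q / (v - q))" "q / (q - u) = - (q / (u - q))"
            by (metis minus_diff_eq minus_divide_right)+
          moreover have "u / (u - q) - q / (u - q) = 1" "v / (v - q) - q / (v - q) = 1"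
            using that by (simp_all add: diff_divide_distrib[symmetric])
          ultimately show ?thesis by (simp add: algebra_simps)
        qed
        show ?thesis
          using *[OF nz(1)[OF \<rho>(2)] nz(3)[OF \<rho>(2)], of x x] *[OF nz(1)[OF \<rho>(3)] nz(3)[OF \<rho>(3)], of x x]
          unfolding \<kappa>_def cpcnj complex_cnj_cnj by (simp add: algebra_simps)
      qed
      have \<kappa>c: "continuous_on A \<kappa>" for A
        unfolding \<kappa>_def using nz \<rho> by (intro continuous_intros cpc) auto
      define h where "h = (\<lambda>t \<zeta>. V (\<phi> \<zeta> + \<i> * of_real t) * G (\<phi> \<zeta>) t)"
      have hT: "s + \<i> * of_real t \<in> T" if "s \<in> \<Omega>" for s t
      proof -
        have "s + \<i> * of_real t = Complex (Re s) (Im s + t)" by (simp add: complex_eq_iff)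
        then show ?thesis using T(2) that closure_subset by (metis subsetD)
      qed
      have h_hol: "h t holomorphic_on ball 0 1" if "t \<in> {-r..r}" for t
      proof -
        have "(\<lambda>\<zeta>. \<phi> \<zeta> + \<i> * of_real t) holomorphic_on ball 0 1"
          by (intro holomorphic_intros \<phi>)
        then have "(\<lambda>\<zeta>. V (\<phi> \<zeta> + \<i> * of_real t)) holomorphic_on ball 0 1"
          using holomorphic_on_compose_gen[OF _ V, of "\<lambda>\<zeta>. \<phi> \<zeta> + \<i> * of_real t" "ball 0 1"] hT \<phi>b
          by (auto simp: o_def image_subset_iff)
        moreover have "(\<lambda>\<zeta>. G (\<phi> \<zeta>) t) holomorphic_on ball 0 1"
          using holomorphic_on_compose_gen[OF \<phi> G_hol[OF that]] \<phi>b by (auto simp: o_def image_subset_iff)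
        ultimately show ?thesis unfolding h_def by (intro holomorphic_intros)
      qed
      have \<phi>cp: "continuous_on A (\<lambda>x. \<phi> (cp x))" for A
        using cpb by (intro continuous_on_compose2[OF holomorphic_on_imp_continuous_on[OF \<phi>] cpc]) auto
      have \<phi>cpO: "\<phi> (cp x) \<in> \<Omega>" for x using \<phi>b cpb by blast
      have joint: "continuous_on (A \<times> {-r..r}) (\<lambda>(x, t). h t (cp x))" for A
        unfolding h_def case_prod_unfold
      proof (intro continuous_on_mult)
        have ph: "continuous_on (A \<times> {-r..r}) (\<lambda>p. \<phi> (cp (fst p)))"
          by (rule continuous_on_compose2[where g = "\<lambda>x. \<phi> (cp x)" and f = fst and t = UNIV, OF \<phi>cp])
             (auto intro: continuous_intros)
        show "continuous_on (A \<times> {-r..r}) (\<lambda>p. V (\<phi> (cp (fst p)) + \<i> * of_real (snd p)))"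
          using hT \<phi>cpO by (intro continuous_on_compose2[OF Vc] continuous_intros ph) auto
        have "continuous_on (A \<times> {-r..r}) (\<lambda>p. (\<lambda>(s, t). G s t) (\<phi> (cp (fst p)), snd p))"
          using \<phi>cpO closure_subset[of \<Omega>]
          by (intro continuous_on_compose2[OF G_cont] continuous_intros ph) auto
        then show "continuous_on (A \<times> {-r..r}) (\<lambda>p. G (\<phi> (cp (fst p))) (snd p))" by simp
      qed
      define W where "W = (\<lambda>x. integral {-r..r} (\<lambda>t. h t (cp x)))"
      have Wc: "continuous_on A W" for A
        using integral_continuous_on_param[of A "-r" r "\<lambda>x t. h t (cp x)"] joint by (simp add: W_def)
      have q12: "\<phi> q1 = s1" "\<phi> q2 = s2" using inv1 s12 by (simp_all add: q1_def q2_def)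
      have "?E = integral {-r..r} (\<lambda>t. h t q1 - h t q2)"
        by (simp add: h_def q12)
      also have "\<dots> = integral {-r..r} (\<lambda>t. integral {0..1} (\<lambda>x. h t (cp x) * \<kappa> x))"
      proof (rule integral_cong)
        fix t assume "t \<in> {-r..r}"
        then have "((\<lambda>x. h t (cp x) * \<kappa> x) has_integral (h t q1 - h t q2)) {0..1}"
          unfolding \<kappa>_def cp_def using R \<rho> \<delta> by (intro Cauchy_circle_odd_kernel h_hol) auto
        then show "h t q1 - h t q2 = integral {0..1} (\<lambda>x. h t (cp x) * \<kappa> x)"
          by (simp add: integral_unique)
      qed
      also have "\<dots> = integral {0..1} (\<lambda>x. integral {-r..r} (\<lambda>t. h t (cp x) * \<kappa> x))"
      proof -
        have "continuous_on (cbox (0, -r) (1, r)) (\<lambda>(x, t). h t (cp x) * \<kappa> x)"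
          using joint[of "{0..1}"] unfolding case_prod_unfold cbox_Pair_eq
          by (intro continuous_on_mult
              continuous_on_compose2[where g = \<kappa> and f = fst and t = UNIV, OF \<kappa>c])
             (auto intro: continuous_intros)
        from integral_swap_continuous[OF this] show ?thesis by simp
      qed
      also have "\<dots> = integral {0..1} (\<lambda>x. W x * \<kappa> x)"
        by (simp add: W_def)
      finally have E: "?E = integral {0..1} (\<lambda>x. W x * \<kappa> x)" .
      have E': "?E = integral {0..1} (\<lambda>x. - (W (1 - x) * \<kappa> x))"
        unfolding E using integral_reflect_unit_interval[of "\<lambda>x. W x * \<kappa> x"] by (simp add: \<kappa>odd)
      have Wc': "continuous_on A (\<lambda>x. W (1 - x))" for A
        by (rule continuous_on_compose2[where g = W and f = "\<lambda>x. 1 - x" and t = UNIV, OF Wc])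
           (auto intro: continuous_intros)
      \<comment> \<open>Averaging the integral with its reflected form brings in the difference
        \<open>W x - W (1 - x)\<close>.\<close>
      have "2 * ?E = ?E + ?E" by simp
      also have "\<dots> = integral {0..1} (\<lambda>x. W x * \<kappa> x) + integral {0..1} (\<lambda>x. - (W (1 - x) * \<kappa> x))"
        using E E' by simp
      also have "\<dots> = integral {0..1} (\<lambda>x. W x * \<kappa> x + - (W (1 - x) * \<kappa> x))"
        by (intro integral_add[symmetric] integrable_continuous_real continuous_intros Wc Wc' \<kappa>c)
      also have "\<dots> = integral {0..1} (\<lambda>x. (W x - W (1 - x)) * \<kappa> x)"
        by (simp add: algebra_simps)
      finally have E2: "2 * ?E = integral {0..1} (\<lambda>x. (W x - W (1 - x)) * \<kappa> x)" .
      \<comment> \<open>\<open>W\<close> with the boundary function \<open>F\<close> in place of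
        \<open>G\<close>; to this \<open>Mdiff\<close> applies.\<close>
      define M where "M = (\<lambda>x. integral {-r..r} (\<lambda>t. V (\<phi> (cp x) + \<i> * of_real t) * F (\<phi> (cp x) + \<i> * of_real t)))"
      have WM: "norm (W x - M x) \<le> BV * e * (2 * r)" for x
      proof -
        have c1: "continuous_on {-r..r} (\<lambda>t. h t (cp x))"
          using continuous_on_compose2[OF joint[of "{x}"], of "{-r..r}" "\<lambda>t. (x, t)"]
          by (auto simp: continuous_on_Pair)
        have c2: "continuous_on {-r..r} (\<lambda>t. V (\<phi> (cp x) + \<i> * of_real t) * F (\<phi> (cp x) + \<i> * of_real t))"
          using hT \<phi>cpO by (intro continuous_intros continuous_on_compose2[OF Vc] continuous_on_compose2[OF F_cont]) auto
        have "W x - M x = integral {-r..r} (\<lambda>t. h t (cp x) - V (\<phi> (cp x) + \<i> * of_real t) * F (\<phi> (cp x) + \<i> * of_real t))"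
          unfolding W_def M_def by (intro integral_diff[symmetric] integrable_continuous_real c1 c2)
        also have "norm \<dots> \<le> BV * e * (r - (-r))"
        proof (rule integral_bound)
          fix t assume t: "t \<in> {-r..r}"
          have "norm (G (\<phi> (cp x)) t - F (\<phi> (cp x) + \<i> * of_real t)) \<le> e"
            using R0(2)[OF \<phi>cpO _ t, of x] inv2[OF cpb[of x]] ncp[of x] R by simp
          moreover have "norm (V (\<phi> (cp x) + \<i> * of_real t)) \<le> BV"
            using BV(2) in_strip \<phi>cpO t by blast
          ultimately show "norm (h t (cp x) - V (\<phi> (cp x) + \<i> * of_real t) * F (\<phi> (cp x) + \<i> * of_real t)) \<le> BV * e"
            unfolding h_def right_diff_distrib[symmetric] norm_mult using BV(1) by (intro mult_mono) auto
        qed (use r_pos in \<open>auto intro!: continuous_intros c1 c2\<close>)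
        finally show ?thesis by simp
      qed
      have MM: "norm (M x - M (1 - x)) \<le> 4 * m * (c * BF)" for x
        using Mdiff[OF \<phi>cpO[of x]] unfolding M_def cpcnj \<phi>c[OF cpb] .
      have WW: "norm (W x - W (1 - x)) \<le> 4 * m * (c * BF) + 2 * (BV * e * (2 * r))" for x
        using WM[of x] WM[of "1-x"] MM[of x] by norm
      have "norm (2 * ?E) \<le> ((4 * m * (c * BF) + 2 * (BV * e * (2 * r))) * (4 / \<delta>)) * (1 - 0)"
        unfolding E2
      proof (rule integral_bound)
        fix x :: real assume "x \<in> {0..1}"
        show "norm ((W x - W (1 - x)) * \<kappa> x) \<le> (4 * m * (c * BF) + 2 * (BV * e * (2 * r))) * (4 / \<delta>)"
          unfolding norm_mult using WW[of x] \<kappa>b[of x] c0 m_nonneg BF BV \<open>0 < e\<close> r_pos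
          by (intro mult_mono) auto
      qed (auto intro!: continuous_intros Wc Wc' \<kappa>c)
      then show ?thesis using \<delta> by (simp add: norm_mult field_simps)
    qed
    show ?thesis
    proof (rule field_le_epsilon)
      fix e' :: real assume "0 < e'"
      define e where "e = e' / (8 / \<delta> * r * BV)"
      have "0 < 8 / \<delta> * r * BV" using \<delta> r_pos BV by simp
      then have "0 < e" "e * (8 / \<delta> * r * BV) = e'"
        unfolding e_def using \<open>0 < e'\<close> by (intro divide_pos_pos, simp_all only: nonzero_eq_divide_eq[symmetric] less_irrefl)
      with est[of e] show "norm ?E \<le> 8 / \<delta> * m * BF * c + e'" by simp
    qed
  qed
  then show thesis by (rule that)
qed

text \<open>The test functions are peak functions rescaled and centred at the point
  \<open>Complex x0 y0\<close>. They are bounded uniformly in \<open>N\<close> at the heights that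
  \<open>test_function_estimate\<close> sees, so the peak integrals of the difference of the two
  extensions stay bounded, and Laplace's method makes the difference vanish at the centre.\<close>

lemma slice_constant:
  assumes s12: "s1 \<in> \<Omega>" "s2 \<in> \<Omega>" "Re s1 = Re s2" and y0: "\<bar>y0\<bar> < r - m"
  shows "G s1 (y0 - Im s1) = G s2 (y0 - Im s2)"
proof -
  define \<rho> where "\<rho> = r - m - \<bar>y0\<bar>"
  \<comment> \<open>\<open>a\<close> is the threshold of \<open>strip_peak_functions\<close>;
    \<open>\<kappa>\<close> stretches \<open>\<rho>\<close>, the distance from \<open>y0\<close> to
    the heights |y| at least \<open>r - m\<close>, to exactly \<open>a\<close>.\<close>
  define a where "a = 3 * pi / 4"
  define \<kappa> where "\<kappa> = a / \<rho>"
  define x0 where "x0 = Re s1"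
  have "0 < \<rho>" "0 < a" using y0 by (auto simp: \<rho>_def a_def)
  then have pos: "0 < \<rho>" "0 < a" "0 < \<kappa>" "\<kappa> * \<rho> = a"
    by (auto simp: \<kappa>_def)
  obtain L where L: "0 < L" "\<And>s. s \<in> closure \<Omega> \<Longrightarrow> \<bar>\<kappa> * (Re s - x0)\<bar> \<le> L"
  proof -
    have "bounded ((\<lambda>s. \<kappa> * (Re s - x0)) ` closure \<Omega>)"
      using compact_closure_dom
      by (intro compact_imp_bounded compact_continuous_image continuous_intros)
    then show ?thesis using that by (auto simp: bounded_pos)
  qed
  obtain V C where V_hol: "\<And>N. V N holomorphic_on {z. \<bar>Re z\<bar> < L + 1}"
    and V_out: "\<And>(N :: nat) z. \<bar>Re z\<bar> \<le> L \<Longrightarrow> a \<le> \<bar>Im z\<bar> \<Longrightarrow> norm (V N z) \<le> C"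
    and V_in: "\<And>N y. \<bar>y\<bar> \<le> a \<Longrightarrow> norm (V N (\<i> * of_real y) - exp (of_real (of_nat N * cos y))) \<le> C"
    using strip_peak_functions[OF L(1)] unfolding a_def by metis
  have C0: "0 \<le> C" using V_in[of 0 undefined] pos by (smt (verit) norm_ge_zero)
  define T where "T = {z. \<bar>\<kappa> * (Re z - x0)\<bar> < L + 1}"
  define P where "P = (\<lambda>N z. V N (of_real \<kappa> * (z - Complex x0 y0)))"
  have P_hol: "P N holomorphic_on T" for N
  proof -
    have "(\<lambda>z. of_real \<kappa> * (z - Complex x0 y0)) holomorphic_on T" by (intro holomorphic_intros)
    then have "(V N \<circ> (\<lambda>z. of_real \<kappa> * (z - Complex x0 y0))) holomorphic_on T"
      by (rule holomorphic_on_compose_gen[OF _ V_hol[of N]]) (auto simp: T_def)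
    then show ?thesis by (simp add: P_def o_def)
  qed
  have T: "open T" "\<And>s y. s \<in> closure \<Omega> \<Longrightarrow> Complex (Re s) y \<in> T"
  proof -
    show "open T" unfolding T_def by (intro open_Collect_less continuous_intros)
    show "Complex (Re s) y \<in> T" if "s \<in> closure \<Omega>" for s y
      using L(2)[OF that] by (simp add: T_def)
  qed
  obtain C1 where C1: "\<And>V c. V holomorphic_on T \<Longrightarrow>
      (\<And>s y. s \<in> \<Omega> \<Longrightarrow> r - m \<le> \<bar>y\<bar> \<Longrightarrow> norm (V (Complex (Re s) y)) \<le> c) \<Longrightarrow>
      norm (integral {-r..r} (\<lambda>t. V (s1 + \<i> * of_real t) * G s1 t - V (s2 + \<i> * of_real t) * G s2 t)) \<le> C1 * c"
    using test_function_estimate[OF s12(1,2) T] by blast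
  have P_est: "norm (integral {-r..r} (\<lambda>t. P N (s1 + \<i> * of_real t) * G s1 t - P N (s2 + \<i> * of_real t) * G s2 t)) \<le> C1 * C" for N
  proof (rule C1[OF P_hol])
    fix s y assume "s \<in> \<Omega>" "r - m \<le> \<bar>y\<bar>"
    then have "\<rho> \<le> \<bar>y - y0\<bar>" by (auto simp: \<rho>_def)
    then have "\<kappa> * \<rho> \<le> \<bar>\<kappa> * (y - y0)\<bar>" using pos(1,3) by (simp add: abs_mult)
    moreover have "\<bar>\<kappa> * (Re s - x0)\<bar> \<le> L" using L(2) \<open>s \<in> \<Omega>\<close> closure_subset by blast
    ultimately show "norm (P N (Complex (Re s) y)) \<le> C"
      unfolding P_def using pos by (intro V_out) auto
  qed
  obtain B where B: "0 < B" "\<And>s t. s \<in> closure \<Omega> \<Longrightarrow> t \<in> {-r..r} \<Longrightarrow> norm (G s t) \<le> B"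
  proof -
    have "bounded ((\<lambda>(s, t). G s t) ` (closure \<Omega> \<times> {-r..r}))"
      using compact_closure_dom
      by (intro compact_imp_bounded compact_continuous_image G_cont compact_Times) auto
    then show ?thesis using that by (force simp: bounded_pos)
  qed
  \<comment> \<open>\<open>W\<close> carries the full test function. \<open>Q\<close> is its main
    part: the exact peak on the window of radius \<open>\<rho>\<close> about
    \<open>y0 - Im s\<close>, in the rescaled variable. By \<open>WQ\<close> they differ, up to the
    factor \<open>\<kappa>\<close>, by an amount bounded in \<open>N\<close>.\<close>
  define W where "W = (\<lambda>N s. integral {-r..r} (\<lambda>t. P N (s + \<i> * of_real t) * G s t))"
  define Q where "Q = (\<lambda>N s. integral {-a..a} (\<lambda>u. exp (of_real (of_nat N * cos u)) * G s (1/\<kappa> * u + (y0 - Im s))))"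
  have Gs: "continuous_on {-r..r} (G s)" if "s \<in> \<Omega>" for s
    using continuous_on_compose2[OF G_cont, of "{-r..r}" "\<lambda>t. (s, t)"] that closure_subset
    by (force simp: continuous_on_Pair)
  have PG: "(\<lambda>t. P N (s + \<i> * of_real t) * G s t) integrable_on {-r..r}" if "s \<in> \<Omega>" for s N
  proof -
    have "s + \<i> * of_real t \<in> T" for t
    proof -
      have "s + \<i> * of_real t = Complex (Re s) (Im s + t)" by (simp add: complex_eq_iff)
      then show ?thesis using T(2) that closure_subset by (metis subsetD)
    qed
    then show ?thesis
      by (intro integrable_continuous_real continuous_intros Gs that
          continuous_on_compose2[OF holomorphic_on_imp_continuous_on[OF P_hol]]) auto
  qed
  have WQ: "norm (of_real \<kappa> * W N s - Q N s) \<le> \<kappa> * (C * B * (2 * r))"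
    and DQ: "(\<lambda>u. exp (of_real (of_nat N * cos u)) * G s (1/\<kappa> * u + (y0 - Im s))) integrable_on {-a..a}"
    and DG: "continuous_on {-a..a} (\<lambda>u. G s (1/\<kappa> * u + (y0 - Im s)))"
    if s: "s \<in> \<Omega>" "Re s = x0" for s N
  proof -
    define c where "c = y0 - Im s"
    \<comment> \<open>The point \<open>s\<close> has height at most \<open>m\<close> and
      \<open>\<rho>\<close> is exactly what remains, so the window stays within the available
      translations.\<close>
    have win: "{c-\<rho>..c+\<rho>} \<subseteq> {-r..r}"
      using height[OF s(1)] unfolding c_def \<rho>_def by auto
    have "continuous_on {-a..a} (\<lambda>u. G s (1/\<kappa> * u + c))"
    proof (rule continuous_on_compose2[OF Gs[OF s(1)]])
      show "continuous_on {-a..a} (\<lambda>u. 1/\<kappa> * u + c)" by (intro continuous_intros)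
      show "(\<lambda>u. 1/\<kappa> * u + c) ` {-a..a} \<subseteq> {-r..r}"
      proof -
        have "1/\<kappa> * u + c \<in> {c-\<rho>..c+\<rho>}" if "u \<in> {-a..a}" for u
          using that pos(3) unfolding pos(4)[symmetric] by (auto simp: field_simps)
        then show ?thesis using win by blast
      qed
    qed
    then show DG': "continuous_on {-a..a} (\<lambda>u. G s (1/\<kappa> * u + (y0 - Im s)))" by (simp add: c_def)
    show "(\<lambda>u. exp (of_real (of_nat N * cos u)) * G s (1/\<kappa> * u + (y0 - Im s))) integrable_on {-a..a}"
      by (intro integrable_continuous_real continuous_intros DG')
    define e where "e = (\<lambda>t. exp (of_real (of_nat N * cos (\<kappa> * (t - c)))) * G s t)"
    have ec: "continuous_on {c-\<rho>..c+\<rho>} e"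
      unfolding e_def by (intro continuous_intros continuous_on_subset[OF Gs[OF s(1)] win])
    define I where "I = integral {c-\<rho>..c+\<rho>} e"
    have I: "(e has_integral I) {c-\<rho>..c+\<rho>}"
      unfolding I_def by (intro integrable_integral integrable_continuous_real ec)
    have "((\<lambda>u. e (1/\<kappa> * u + c)) has_integral of_real \<kappa> * I) {-a..a}"
      using has_integral_affinity'[of e I "c-\<rho>" "c+\<rho>" "1/\<kappa>" c] I pos
      by (simp add: scaleR_conv_of_real mult.commute)
    moreover have "e (1/\<kappa> * u + c) = exp (of_real (of_nat N * cos u)) * G s (1/\<kappa> * u + (y0 - Im s))" for u
      using pos by (simp add: e_def c_def)
    ultimately have Q: "Q N s = of_real \<kappa> * I"
      unfolding Q_def by (simp add: integral_unique)
    have "((\<lambda>t. if t \<in> {c-\<rho>..c+\<rho>} then e t else 0) has_integral I) {-r..r}"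
      using I unfolding has_integral_restrict[OF win] .
    then have d: "((\<lambda>t. P N (s + \<i> * of_real t) * G s t - (if t \<in> {c-\<rho>..c+\<rho>} then e t else 0)) has_integral (W N s - I)) {-r..r}"
      unfolding W_def by (intro has_integral_diff integrable_integral PG s)
    have "norm (W N s - I) \<le> C * B * measure lborel {-r..r}"
    proof (rule has_integral_bound_real[OF _ finite.emptyI d])
      show "0 \<le> C * B" using C0 B by simp
      fix t assume "t \<in> {-r..r} - {}"
      then have t: "t \<in> {-r..r}" by simp
      have arg: "of_real \<kappa> * (s + \<i> * of_real t - Complex x0 y0) = \<i> * of_real (\<kappa> * (t - c))"
        using s(2) by (simp add: complex_eq_iff c_def algebra_simps)
      \<comment> \<open>Inside the window the peak function is within \<open>C\<close> of the
        exponential; outside it is itself bounded by \<open>C\<close>.\<close>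
      have "norm (P N (s + \<i> * of_real t) - (if t \<in> {c-\<rho>..c+\<rho>} then exp (of_real (of_nat N * cos (\<kappa> * (t - c)))) else 0)) \<le> C"
      proof (cases "t \<in> {c-\<rho>..c+\<rho>}")
        case True
        then have "\<kappa> * \<bar>t - c\<bar> \<le> \<kappa> * \<rho>" using pos by (intro mult_left_mono) auto
        then show ?thesis
          unfolding P_def arg using V_in[of "\<kappa> * (t - c)" N] True pos by (simp add: abs_mult)
      next
        case False
        then have "\<kappa> * \<rho> \<le> \<kappa> * \<bar>t - c\<bar>" using pos by (intro mult_left_mono) auto
        then show ?thesis
          unfolding P_def arg if_not_P[OF False] diff_zero
          using pos L(1) by (intro V_out) (simp_all add: abs_mult)
      qed
      moreover have "norm (G s t) \<le> B" using B(2) s(1) t closure_subset by blast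
      ultimately have "norm ((P N (s + \<i> * of_real t) - (if t \<in> {c-\<rho>..c+\<rho>} then exp (of_real (of_nat N * cos (\<kappa> * (t - c)))) else 0)) * G s t) \<le> C * B"
        unfolding norm_mult using C0 by (intro mult_mono) auto
      moreover have "(P N (s + \<i> * of_real t) - (if t \<in> {c-\<rho>..c+\<rho>} then exp (of_real (of_nat N * cos (\<kappa> * (t - c)))) else 0)) * G s t
          = P N (s + \<i> * of_real t) * G s t - (if t \<in> {c-\<rho>..c+\<rho>} then e t else 0)"
        by (simp add: e_def algebra_simps)
      ultimately show "norm (P N (s + \<i> * of_real t) * G s t - (if t \<in> {c-\<rho>..c+\<rho>} then e t else 0)) \<le> C * B"
        by simp
    qed
    then have "norm (W N s - I) \<le> C * B * (2 * r)" using r_pos by simp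
    then have "\<kappa> * norm (W N s - I) \<le> \<kappa> * (C * B * (2 * r))" using pos by (intro mult_left_mono) auto
    moreover have "of_real \<kappa> * W N s - Q N s = of_real \<kappa> * (W N s - I)"
      unfolding Q by (simp add: algebra_simps)
    ultimately show "norm (of_real \<kappa> * W N s - Q N s) \<le> \<kappa> * (C * B * (2 * r))"
      using pos by (simp add: norm_mult)
  qed
  have s1: "s1 \<in> \<Omega>" "Re s1 = x0" and s2: "s2 \<in> \<Omega>" "Re s2 = x0"
    using s12 by (auto simp: x0_def)
  define D where "D = (\<lambda>u. G s1 (1/\<kappa> * u + (y0 - Im s1)) - G s2 (1/\<kappa> * u + (y0 - Im s2)))"
  have "D 0 = 0"
  proof (rule peak_integral_bounded_imp_zero)
    show "0 < a" "a \<le> pi" by (simp_all add: a_def)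
    show "continuous_on {-a..a} D"
      unfolding D_def by (intro continuous_intros DG s1 s2)
    fix N
    have eq: "integral {-a..a} (\<lambda>u. exp (of_real (of_nat N * cos u)) * D u) = Q N s1 - Q N s2"
      unfolding Q_def D_def right_diff_distrib
      by (intro Henstock_Kurzweil_Integration.integral_diff DQ s1 s2)
    have *: "norm (of_real \<kappa> * (W N s1 - W N s2)) \<le> \<kappa> * (C1 * C)"
    proof -
      have "W N s1 - W N s2 = integral {-r..r} (\<lambda>t. P N (s1 + \<i> * of_real t) * G s1 t - P N (s2 + \<i> * of_real t) * G s2 t)"
        unfolding W_def by (intro Henstock_Kurzweil_Integration.integral_diff[symmetric] PG s1 s2)
      then show ?thesis using P_est[of N] pos by (simp add: norm_mult)
    qed
    note eq
    moreover have "Q N s1 - Q N s2 = of_real \<kappa> * (W N s1 - W N s2) - (of_real \<kappa> * W N s1 - Q N s1) + (of_real \<kappa> * W N s2 - Q N s2)"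
      by (simp add: algebra_simps)
    moreover have "norm (x - y + z) \<le> norm x + norm y + norm z" for x y z :: complex by norm
    ultimately have "norm (integral {-a..a} (\<lambda>u. exp (of_real (of_nat N * cos u)) * D u)) \<le>
        norm (of_real \<kappa> * (W N s1 - W N s2)) + norm (of_real \<kappa> * W N s1 - Q N s1) + norm (of_real \<kappa> * W N s2 - Q N s2)"
      by metis
    also have "\<dots> \<le> \<kappa> * (C1 * C) + \<kappa> * (C * B * (2 * r)) + \<kappa> * (C * B * (2 * r))"
      by (intro add_mono WQ s1 s2 *)
    finally show "norm (integral {-a..a} (\<lambda>u. exp (of_real (of_nat N * cos u)) * D u)) \<le>
        \<kappa> * (C1 * C) + \<kappa> * (C * B * (2 * r)) + \<kappa> * (C * B * (2 * r))" .
  qed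
  then show ?thesis by (simp add: D_def)
qed

section \<open>Analytic continuation in the translation parameter\<close>

lemma connected_dom: "connected \<Omega>"
  using simply_connected_dom by (rule simply_connected_imp_connected)

text \<open>For nonnegative \<open>t\<close>, points of the domain near height \<open>-m\<close> are
  moved to height below \<open>r - m\<close>. If such a point ends up too low, \<open>-t\<close>
  lies between its height and 0, and connectedness gives a point moved exactly to height 0. Negative
  \<open>t\<close> follows by conjugation.\<close>

lemma exists_low_translate:
  assumes "\<bar>t\<bar> < r"
  obtains s where "s \<in> \<Omega>" "\<bar>Im s + t\<bar> < r - m"
proof -
  have nonneg: "\<exists>s\<in>\<Omega>. \<bar>Im s + t\<bar> < r - m" if t: "0 \<le> t" "t < r" for t
  proof -
    obtain b where b: "b \<in> closure \<Omega>" "Im b = m" using height_sharp by blast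
    obtain b' where b': "b' \<in> \<Omega>" "dist b' b < r - t"
      using b(1) t(2) unfolding closure_approachable by (metis diff_gt_0_iff_gt)
    have "\<bar>Im b' - Im b\<bar> < r - t"
      using abs_Im_le_cmod[of "b' - b"] b'(2) by (simp add: dist_norm)
    then have low: "Im (cnj b') + t < r - m" using b(2) by simp
    show ?thesis
    proof (cases "- (r - m) < Im (cnj b') + t")
      case True
      then show ?thesis using low cnj_in_dom[OF b'(1)] by (intro bexI[of _ "cnj b'"]) auto
    next
      case False
      obtain p where p: "p \<in> \<Omega>" "Im p = 0"
        using connected_symmetric_real_point[OF connected_dom nonempty_dom cnj_dom] by blast
      have "connected (Im ` \<Omega>)"
        using connected_dom by (intro connected_continuous_image continuous_intros)
      then have "- t \<in> Im ` \<Omega>"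
        by (rule connectedD_interval[of _ "Im (cnj b')" "Im p"])
           (use False p imageI[OF cnj_in_dom[OF b'(1)], of Im] imageI[OF p(1), of Im] m_less t in auto)
      then obtain s where "s \<in> \<Omega>" "Im s = - t" by auto
      then show ?thesis using m_less by (intro bexI[of _ s]) auto
    qed
  qed
  show thesis
  proof (cases "0 \<le> t")
    case True
    then show ?thesis using nonneg[of t] assms that by auto
  next
    case False
    then obtain s where s: "s \<in> \<Omega>" "\<bar>Im s + - t\<bar> < r - m" using nonneg[of "-t"] assms by auto
    have "\<bar>Im (cnj s) + t\<bar> < r - m" using s(2) by (simp add: abs_minus_commute)
    with cnj_in_dom[OF s(1)] show ?thesis by (rule that)
  qed
qed

text \<open>Join \<open>s\<close> to a point \<open>b\<close> where \<open>slice_constant\<close>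
  applies. A small change of \<open>t\<close> keeps the compact path inside both translates of the
  domain, and the identity theorem carries the agreement near \<open>b\<close> back to
  \<open>s\<close>.\<close>

lemma extension_locally_constant:
  assumes s: "s \<in> \<Omega>" and t0: "\<bar>t0\<bar> < r"
  obtains e where "0 < e"
    "\<And>t. \<bar>t - t0\<bar> < e \<Longrightarrow> \<bar>t\<bar> < r \<Longrightarrow> G (s - \<i> * of_real (t - t0)) t = G s t0"
proof -
  obtain b where b: "b \<in> \<Omega>" "\<bar>Im b + t0\<bar> < r - m" using exists_low_translate[OF t0] by blast
  have "path_connected \<Omega>"
    using connected_dom open_dom by (simp add: connected_open_path_connected)
  then obtain g where g: "path g" "path_image g \<subseteq> \<Omega>" "pathstart g = s" "pathfinish g = b"
    using s b(1) unfolding path_connected_def by blast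
  obtain e where e: "0 < e" "(\<Union>w\<in>path_image g. ball w e) \<subseteq> \<Omega>"
    using compact_subset_open_imp_ball_epsilon_subset[OF compact_path_image[OF g(1)] open_dom g(2)] by metis
  show thesis
  proof (rule that[OF e(1)])
    fix t assume t: "\<bar>t - t0\<bar> < e" "\<bar>t\<bar> < r"
    define d where "d = \<i> * of_real (t - t0)"
    \<comment> \<open>The points where both extensions are defined; the identity theorem is applied
      on the component \<open>U'\<close> of \<open>s\<close>, which contains the whole path.\<close>
    define U where "U = \<Omega> \<inter> (\<lambda>w. w - d) -` \<Omega>"
    have "open U"
      unfolding U_def using open_dom by (intro open_Int open_vimage continuous_intros)
    have gU: "path_image g \<subseteq> U"
    proof
      fix w assume w: "w \<in> path_image g"
      have "norm d = \<bar>t - t0\<bar>" unfolding d_def norm_mult norm_of_real by simp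
      then have "w - d \<in> ball w e" using t(1) by (simp add: dist_norm)
      then have "w - d \<in> \<Omega>" using w e(2) by blast
      then show "w \<in> U" using w g(2) by (auto simp: U_def)
    qed
    define U' where "U' = connected_component_set U s"
    have U': "open U'" "connected U'" "U' \<subseteq> U"
      using \<open>open U\<close> by (auto simp: U'_def open_connected_component connected_component_subset)
    have gU': "path_image g \<subseteq> U'"
      unfolding U'_def using g gU
      by (intro connected_component_maximal connected_path_image) (auto simp: pathstart_in_path_image)
    have sU: "s \<in> U'" "b \<in> U'"
      using gU' g by (metis pathstart_in_path_image pathfinish_in_path_image subsetD)+
    define H where "H = (\<lambda>w. G (w - d) t - G w t0)"
    have H_hol: "H holomorphic_on U'"
    proof -
      have "((\<lambda>w. G w t) \<circ> (\<lambda>w. w - d)) holomorphic_on U'"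
        using U'(3) t(2) by (intro holomorphic_on_compose_gen[OF _ G_hol] holomorphic_intros) (auto simp: U_def)
      moreover have "(\<lambda>w. G w t0) holomorphic_on U'"
        using U'(3) t0 by (intro holomorphic_on_subset[OF G_hol]) (auto simp: U_def)
      ultimately show ?thesis unfolding H_def by (auto simp: o_def intro!: holomorphic_intros)
    qed
    \<comment> \<open>Here \<open>slice_constant\<close> applies to the pair \<open>w - d\<close>,
      \<open>w\<close>, which have equal real parts.\<close>
    define N where "N = U' \<inter> {w. \<bar>Im w + t0\<bar> < r - m}"
    have "open N"
      unfolding N_def using U'(1) by (intro open_Int open_Collect_less continuous_intros)
    have "b \<in> N" using sU b by (simp add: N_def)
    have "H s = 0"
    proof (rule analytic_continuation[OF H_hol U'(1,2) _ sU(2) _ _ sU(1)])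
      show "N \<subseteq> U'" by (simp add: N_def)
      show "b islimpt N" using \<open>open N\<close> \<open>b \<in> N\<close> by (simp add: interior_limit_point interior_open)
      fix w assume "w \<in> N"
      then have w: "w \<in> \<Omega>" "w - d \<in> \<Omega>" "\<bar>Im w + t0\<bar> < r - m" using U'(3) by (auto simp: N_def U_def)
      show "H w = 0"
        using slice_constant[OF w(2) w(1) _ w(3)] by (simp add: H_def d_def)
    qed
    then show "G (s - \<i> * of_real (t - t0)) t = G s t0" by (simp add: H_def d_def)
  qed
qed

text \<open>Keep \<open>z = s + \<i> * of_real t0\<close> fixed and move \<open>t\<close> until
  \<open>z - \<i> * of_real t\<close> first leaves the domain. The value is constant on the way, and
  at the exit point, which lies on the frontier, it is \<open>F z\<close>.\<close>

lemma extension_eq: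
  assumes s: "s \<in> \<Omega>" and t0: "\<bar>t0\<bar> < r"
  shows "G s t0 = F (s + \<i> * of_real t0)"
proof -
  define z where "z = s + \<i> * of_real t0"
  define \<tau> where "\<tau> = (\<lambda>\<sigma> u. t0 + \<sigma> * u)"
  \<comment> \<open>The direction of motion: \<open>z + \<i> * of_real r\<close> and
    \<open>z - \<i> * of_real r\<close> differ in height by \<open>2 * r\<close>, more than the
    height \<open>2 * m\<close> of the domain, so one of them is outside.\<close>
  obtain \<sigma> :: real where \<sigma>: "\<sigma> = 1 \<or> \<sigma> = -1" "z - \<i> * of_real (\<sigma> * r) \<notin> \<Omega>"
  proof -
    have "z - \<i> * of_real r \<notin> \<Omega> \<or> z + \<i> * of_real r \<notin> \<Omega>"
      using height[of "z - \<i> * of_real r"] height[of "z + \<i> * of_real r"] m_less by auto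
    then show ?thesis using that[of 1] that[of "-1"] by auto
  qed
  define p where "p = (\<lambda>u. z - \<i> * of_real (t0 + \<sigma> * u))"
  define l where "l = r - \<sigma> * t0"
  have l: "0 < l" using t0 \<sigma>(1) by (auto simp: l_def)
  have pc: "continuous_on A p" for A unfolding p_def by (intro continuous_intros)
  have p0: "p 0 = s" by (simp add: p_def z_def)
  have pl: "p l \<notin> \<Omega>" using \<sigma> by (auto simp: p_def l_def algebra_simps)
  define A where "A = {0..l} \<inter> p -` (- \<Omega>)"
  have "closed A"
    unfolding A_def using open_dom by (intro continuous_closed_preimage pc) auto
  moreover have "l \<in> A" using pl l by (simp add: A_def)
  moreover have bdd: "bdd_below A" unfolding A_def by (intro bdd_belowI[of _ 0]) auto
  ultimately have "Inf A \<in> A" by (intro closed_contains_Inf) auto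
  define v where "v = Inf A"
  have v: "v \<in> {0..l}" "p v \<notin> \<Omega>" using \<open>Inf A \<in> A\<close> by (auto simp: A_def v_def)
  have "v \<noteq> 0" using v(2) p0 s by auto
  then have "0 < v" using v(1) by simp
  have below: "p u \<in> \<Omega>" if "u \<in> {0..<v}" for u
  proof (rule ccontr)
    assume "p u \<notin> \<Omega>"
    then have "u \<in> A" using that v(1) by (auto simp: A_def)
    then have "v \<le> u" unfolding v_def by (rule cInf_lower[OF _ bdd])
    then show False using that by simp
  qed
  have cl: "closure {0..<v} = {0..v}" using \<open>0 < v\<close> by (rule closure_atLeastLessThan)
  have pcl: "p u \<in> closure \<Omega>" if "u \<in> {0..v}" for u
    using image_closure_subset[OF pc[of "closure {0..<v}"] closed_closure, of \<Omega>] below that closure_subset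
    unfolding cl by blast
  have range: "t0 + \<sigma> * u \<in> {-r..r}" if "u \<in> {0..v}" for u
    using that v(1) t0 \<sigma>(1) by (auto simp: l_def)
  have range': "\<bar>t0 + \<sigma> * u\<bar> < r" if "u \<in> {0..<v}" for u
    using that v(1) t0 \<sigma>(1) by (auto simp: l_def)
  define c where "c = (\<lambda>u. G (p u) (t0 + \<sigma> * u))"
  have cc: "continuous_on {0..v} c"
  proof -
    have "continuous_on {0..v} (\<lambda>u. (p u, t0 + \<sigma> * u))" by (intro continuous_intros pc)
    moreover have "(\<lambda>u. (p u, t0 + \<sigma> * u)) ` {0..v} \<subseteq> closure \<Omega> \<times> {-r..r}"
      using pcl range by blast
    ultimately have "continuous_on {0..v} (\<lambda>u. (\<lambda>(s, t). G s t) (p u, t0 + \<sigma> * u))"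
      by (rule continuous_on_compose2[OF G_cont])
    then show ?thesis by (simp add: c_def)
  qed
  have const: "c u = c 0" if u: "u \<in> {0..<v}" for u
  proof (rule connected_local_const[of "{0..<v}"])
    show "\<forall>a\<in>{0..<v}. eventually (\<lambda>b. c a = c b) (at a within {0..<v})"
    proof
      fix a assume a: "a \<in> {0..<v}"
      obtain e where e: "0 < e"
        "\<And>t. \<bar>t - (t0 + \<sigma> * a)\<bar> < e \<Longrightarrow> \<bar>t\<bar> < r \<Longrightarrow> G (p a - \<i> * of_real (t - (t0 + \<sigma> * a))) t = G (p a) (t0 + \<sigma> * a)"
        using extension_locally_constant[OF below[OF a] range'[OF a]] by blast
      have "c a = c b" if "b \<in> {0..<v}" "dist b a < e" for b
      proof -
        have "\<bar>(t0 + \<sigma> * b) - (t0 + \<sigma> * a)\<bar> < e"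
          using that(2) \<sigma>(1) by (auto simp: dist_real_def)
        from e(2)[OF this range'[OF that(1)]]
        have "G (p a - \<i> * of_real ((t0 + \<sigma> * b) - (t0 + \<sigma> * a))) (t0 + \<sigma> * b) = c a" by (simp add: c_def)
        moreover have "p a - \<i> * of_real ((t0 + \<sigma> * b) - (t0 + \<sigma> * a)) = p b"
          by (simp add: p_def algebra_simps)
        ultimately show ?thesis by (simp add: c_def)
      qed
      then show "eventually (\<lambda>b. c a = c b) (at a within {0..<v})"
        unfolding eventually_at using e(1) by blast
    qed
  qed (use u \<open>0 < v\<close> in auto)
  \<comment> \<open>Local constancy holds only for |t| < \<open>r\<close>, and the exit may occur at
    an endpoint of the range; joint continuity of \<open>G\<close> covers this last step.\<close>
  have "c v = c 0"
  proof (rule continuous_constant_on_closure[of "{0..<v}" c])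
    show "continuous_on (closure {0..<v}) c" unfolding cl by (rule cc)
    show "v \<in> closure {0..<v}" unfolding cl using \<open>0 < v\<close> by simp
  qed (rule const)
  moreover have "p v \<in> frontier \<Omega>"
    using pcl[of v] v(2) \<open>0 < v\<close> open_dom by (simp add: frontier_def interior_open)
  then have "c v = F (p v + \<i> * of_real (t0 + \<sigma> * v))"
    unfolding c_def using range[of v] \<open>0 < v\<close> by (intro G_eq) auto
  ultimately show ?thesis by (simp add: c_def p_def z_def)
qed

lemma F_holomorphic_on_open_sweep: "F holomorphic_on {z. \<exists>t. \<bar>t\<bar> < r \<and> z - \<i> * of_real t \<in> \<Omega>}"
proof -
  have "F holomorphic_on {z. z - \<i> * of_real t \<in> \<Omega>}" if "\<bar>t\<bar> < r" for t
  proof -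
    have "((\<lambda>w. G w t) \<circ> (\<lambda>z. z - \<i> * of_real t)) holomorphic_on {z. z - \<i> * of_real t \<in> \<Omega>}"
      using that by (intro holomorphic_on_compose_gen[OF _ G_hol] holomorphic_intros) auto
    then show ?thesis
      by (rule holomorphic_transform) (use that extension_eq in auto)
  qed
  moreover have "open {z. z - \<i> * of_real t \<in> \<Omega>}" for t
    using open_vimage[OF open_dom, of "\<lambda>z. z - \<i> * of_real t"] by (simp add: vimage_def continuous_intros)
  ultimately have "F holomorphic_on (\<Union>t\<in>{t. \<bar>t\<bar> < r}. {z. z - \<i> * of_real t \<in> \<Omega>})"
    by (intro holomorphic_on_UN_open) auto
  moreover have "{z. \<exists>t. \<bar>t\<bar> < r \<and> z - \<i> * of_real t \<in> \<Omega>} = (\<Union>t\<in>{t. \<bar>t\<bar> < r}. {z. z - \<i> * of_real t \<in> \<Omega>})"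
    by auto
  ultimately show ?thesis by simp
qed

end

section \<open>Real analytic curves and vertical lines\<close>

text \<open>The power series that represents the curve near \<open>s\<close> also converges in the
  complex disc of the same radius.\<close>

lemma real_analytic_local_extension:
  assumes "real_analytic \<gamma>"
  obtains e \<Gamma> where "0 < e" "\<Gamma> holomorphic_on ball (of_real s) e"
    "\<And>t. \<bar>t - s\<bar> < e \<Longrightarrow> \<Gamma> (of_real t) = \<gamma> t"
    "\<And>t. \<bar>t - s\<bar> < e \<Longrightarrow> (\<gamma> has_vector_derivative deriv \<Gamma> (of_real t)) (at t)"
proof -
  obtain a e where e: "0 < e" and sums: "\<And>t. \<bar>t - s\<bar> < e \<Longrightarrow> (\<lambda>n. a n * of_real (t - s) ^ n) sums \<gamma> t"
    using assms unfolding real_analytic_def by blast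
  define \<Gamma> where "\<Gamma> = (\<lambda>w. \<Sum>n. a n * (w - of_real s) ^ n)"
  have S: "(\<lambda>n. a n * (w - of_real s) ^ n) sums \<Gamma> w" if w: "w \<in> ball (of_real s) e" for w
  proof -
    \<comment> \<open>A real radius between |w - s| and \<open>e\<close>: convergence at
      \<open>s + d\<close> implies convergence at \<open>w\<close>.\<close>
    define d where "d = (norm (w - of_real s) + e) / 2"
    have d: "norm (w - of_real s) < d" "d < e" "0 \<le> d"
      using w e by (auto simp: d_def dist_norm norm_minus_commute field_simps add_nonneg_nonneg less_imp_le)
    have "summable (\<lambda>n. a n * of_real d ^ n)"
      using sums[of "s + d"] d by (auto simp: sums_iff)
    then have "summable (\<lambda>n. a n * (w - of_real s) ^ n)"
      by (rule powser_inside) (use d in auto)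
    then show ?thesis unfolding \<Gamma>_def by (rule summable_sums)
  qed
  have hol: "\<Gamma> holomorphic_on ball (of_real s) e"
    by (rule power_series_holomorphic[OF S])
  have eq: "\<Gamma> (of_real t) = \<gamma> t" if "\<bar>t - s\<bar> < e" for t
    using sums[OF that] by (simp add: \<Gamma>_def sums_iff)
  have inball: "of_real t \<in> ball (of_real s :: complex) e" if "\<bar>t - s\<bar> < e" for t
    using that by (simp add: dist_of_real dist_real_def abs_minus_commute)
  have der: "(\<gamma> has_vector_derivative deriv \<Gamma> (of_real t)) (at t)" if t: "\<bar>t - s\<bar> < e" for t
  proof -
    have "(\<Gamma> has_field_derivative deriv \<Gamma> (of_real t)) (at (of_real t))"
      using hol inball[OF t] by (intro holomorphic_derivI[of _ "ball (of_real s) e"]) auto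
    moreover have "((\<lambda>t. of_real t :: complex) has_vector_derivative 1) (at t)"
      by (auto intro!: derivative_eq_intros simp: has_vector_derivative_def scaleR_conv_of_real)
    ultimately have "(\<Gamma> \<circ> of_real has_vector_derivative 1 * deriv \<Gamma> (of_real t)) (at t)"
      by (intro field_vector_diff_chain_at)
    then have D: "(\<Gamma> \<circ> of_real has_vector_derivative deriv \<Gamma> (of_real t)) (at t)" by simp
    show ?thesis
      by (rule has_vector_derivative_transform_within_open[OF D, of "ball s e"])
         (use t eq in \<open>auto simp: dist_real_def abs_minus_commute\<close>)
  qed
  show thesis by (rule that[OF e hol eq der])
qed

lemma real_analytic_imp_has_vector_derivative:
  assumes "real_analytic \<gamma>"
  shows "(\<gamma> has_vector_derivative vector_derivative \<gamma> (at t)) (at t)"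
proof -
  obtain e \<Gamma> where "0 < e" and d: "\<And>u. \<bar>u - t\<bar> < e \<Longrightarrow> (\<gamma> has_vector_derivative deriv \<Gamma> (of_real u)) (at u)"
    by (rule real_analytic_local_extension[OF assms, of t]) (rule that)
  then have "(\<gamma> has_vector_derivative deriv \<Gamma> (of_real t)) (at t)" by simp
  then show ?thesis by (simp add: vector_derivative_at)
qed

lemma periodic_add_int:
  fixes \<gamma> :: "real \<Rightarrow> 'a"
  assumes per: "\<And>t. \<gamma> (t + 1) = \<gamma> t"
  shows "\<gamma> (t + of_int n) = \<gamma> t"
proof -
  have *: "\<gamma> (t + of_nat k) = \<gamma> t" for k t
    by (induction k) (simp_all add: per add.assoc[symmetric] add.commute[of 1])
  show ?thesis
  proof (cases "n \<ge> 0")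
    case True
    then show ?thesis using *[of t "nat n"] by simp
  next
    case False
    then show ?thesis using *[of "t + of_int n" "nat (-n)"] by simp
  qed
qed

text \<open>Both parameters reduce to fractional parts, where a simple path is injective; a
  difference below 1 leaves no nonzero integer.\<close>

lemma periodic_simple_path_unique:
  fixes \<gamma> :: "real \<Rightarrow> complex"
  assumes "simple_path \<gamma>" and per: "\<And>t. \<gamma> (t + 1) = \<gamma> t"
    and eq: "\<gamma> u = \<gamma> v" "\<bar>u - v\<bar> < 1"
  shows "u = v"
proof -
  have fr: "\<gamma> (frac t) = \<gamma> t" for t
    using periodic_add_int[of \<gamma> t "- \<lfloor>t\<rfloor>", OF per] by (simp add: frac_def)
  have "\<gamma> (frac u) = \<gamma> (frac v)" using eq fr by simp
  then have "frac u = frac v"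
    using assms(1) frac_lt_1[of u] frac_lt_1[of v] frac_ge_0[of u] frac_ge_0[of v]
    unfolding simple_path_def loop_free_def by fastforce
  then have "u - v = of_int (\<lfloor>u\<rfloor> - \<lfloor>v\<rfloor>)" by (simp add: frac_def)
  moreover from this have "\<lfloor>u\<rfloor> - \<lfloor>v\<rfloor> = 0" using eq(2) by linarith
  ultimately show ?thesis by simp
qed

text \<open>Recentres the parameter interval so that \<open>\<theta>\<close> is an interior point,
  even when it is 0 or 1.\<close>

lemma periodic_path_image:
  fixes \<gamma> :: "real \<Rightarrow> complex"
  assumes per: "\<And>t. \<gamma> (t + 1) = \<gamma> t"
  shows "path_image \<gamma> = \<gamma> ` {\<theta> - 1/2..\<theta> + 1/2}"
proof -
  have "\<exists>u\<in>{a..a+1}. \<gamma> u = \<gamma> t" for a t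
  proof (intro bexI[of _ "t + of_int (- \<lfloor>t - a\<rfloor>)"])
    show "\<gamma> (t + of_int (- \<lfloor>t - a\<rfloor>)) = \<gamma> t" by (rule periodic_add_int) (rule per)
    show "t + of_int (- \<lfloor>t - a\<rfloor>) \<in> {a..a + 1}" by simp linarith
  qed
  then have *: "\<gamma> ` A \<subseteq> \<gamma> ` {a..a+1}" for A a by (metis image_eqI image_subsetI)
  show ?thesis
  proof -
    have "\<theta> - 1/2 + 1 = \<theta> + 1/2" by simp
    then show ?thesis
      unfolding path_image_def using *[of "{0..1}" "\<theta> - 1/2"] *[of "{\<theta> - 1/2..\<theta> + 1/2}" 0]
      by (metis add_0 subset_antisym)
  qed
qed

text \<open>The local extension \<open>\<Gamma>\<close> straightens the curve to the real axis, and
  one half-disc is mapped into the domain. The vertical line is transversal to the curve because Re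
  of the velocity is nonzero, so it enters this half-disc.\<close>

lemma vertical_line_meets_domain:
  fixes \<gamma> :: "real \<Rightarrow> complex"
  assumes an: "real_analytic \<gamma>" and per: "\<And>t. \<gamma> (t + 1) = \<gamma> t" and simp: "simple_path \<gamma>"
    and im: "path_image \<gamma> = frontier \<Omega>" and op: "open \<Omega>"
    and \<theta>: "Re (vector_derivative \<gamma> (at \<theta>)) \<noteq> 0" and \<eta>: "0 < \<eta>"
  obtains \<epsilon> where "\<bar>\<epsilon>\<bar> < \<eta>" "\<gamma> \<theta> + \<i> * of_real \<epsilon> \<in> \<Omega>"
proof -
  obtain e \<Gamma> where e: "0 < e" and \<Gamma>: "\<Gamma> holomorphic_on ball (of_real \<theta>) e"
    and \<Gamma>eq: "\<And>t. \<bar>t - \<theta>\<bar> < e \<Longrightarrow> \<Gamma> (of_real t) = \<gamma> t"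
    and \<Gamma>d: "\<And>t. \<bar>t - \<theta>\<bar> < e \<Longrightarrow> (\<gamma> has_vector_derivative deriv \<Gamma> (of_real t)) (at t)"
    by (rule real_analytic_local_extension[OF an, of \<theta>]) (rule that)
  define c where "c = deriv \<Gamma> (of_real \<theta>)"
  have "vector_derivative \<gamma> (at \<theta>) = c"
    unfolding c_def using \<Gamma>d[of \<theta>] e by (intro vector_derivative_at) auto
  then have c: "Re c \<noteq> 0" using \<theta> by simp
  then have "c \<noteq> 0" by auto
  have "of_real \<theta> \<in> ball (complex_of_real \<theta>) e" using e by simp
  then obtain r0 where r0: "0 < r0" "ball (complex_of_real \<theta>) r0 \<subseteq> ball (complex_of_real \<theta>) e"
      "inj_on \<Gamma> (ball (of_real \<theta>) r0)"
    using has_complex_derivative_locally_injective[OF \<Gamma> _ open_ball] \<open>c \<noteq> 0\<close> unfolding c_def by metis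
  have r0e: "r0 \<le> e" using r0(1,2) e by (simp add: ball_subset_ball_iff)
  have eq0: "\<Gamma> (of_real t) = \<gamma> t" "of_real t \<in> ball (of_real \<theta> :: complex) r0" if "\<bar>t - \<theta>\<bar> < r0" for t
    using that r0e \<Gamma>eq[of t] by (auto simp: dist_of_real dist_real_def abs_minus_commute)
  \<comment> \<open>The rest of the curve: a compact set which misses
    \<open>\<gamma> \<theta>\<close> because the curve is simple. After shrinking the disc to
    \<open>D\<close>, only real parameters are mapped to the frontier.\<close>
  define C' where "C' = \<gamma> ` ({\<theta> - 1/2..\<theta> + 1/2} - {\<theta> - r0<..<\<theta> + r0})"
  have \<gamma>c: "continuous_on A \<gamma>" for A
    using real_analytic_imp_has_vector_derivative[OF an]
    by (intro continuous_at_imp_continuous_on ballI) (rule has_vector_derivative_continuous)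
  have "compact ({\<theta> - 1/2..\<theta> + 1/2} - {\<theta> - r0<..<\<theta> + r0})"
    by (intro compact_diff) auto
  then have "closed C'"
    unfolding C'_def by (intro compact_imp_closed compact_continuous_image \<gamma>c)
  have "\<gamma> \<theta> \<notin> C'"
  proof
    assume "\<gamma> \<theta> \<in> C'"
    then obtain u where u: "\<gamma> u = \<gamma> \<theta>" "u \<in> {\<theta> - 1/2..\<theta> + 1/2}" "u \<notin> {\<theta> - r0<..<\<theta> + r0}"
      by (auto simp: C'_def)
    have "u = \<theta>" by (rule periodic_simple_path_unique[OF simp per u(1)]) (use u(2) in auto)
    then show False using u(3) r0(1) by simp
  qed
  have \<Gamma>0: "\<Gamma> holomorphic_on ball (of_real \<theta>) r0" using \<Gamma> r0(2) by (rule holomorphic_on_subset)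
  have "open (ball (of_real \<theta>) r0 \<inter> \<Gamma> -` (- C'))"
    using \<open>closed C'\<close> by (intro continuous_open_preimage holomorphic_on_imp_continuous_on \<Gamma>0) auto
  moreover have "of_real \<theta> \<in> ball (of_real \<theta>) r0 \<inter> \<Gamma> -` (- C')"
    using r0(1) \<open>\<gamma> \<theta> \<notin> C'\<close> eq0[of \<theta>] by simp
  ultimately obtain r1 where r1: "0 < r1" "ball (of_real \<theta>) r1 \<subseteq> ball (of_real \<theta>) r0 \<inter> \<Gamma> -` (- C')"
    by (meson open_contains_ball)
  define D where "D = ball (complex_of_real \<theta>) r1"
  have D0: "D \<subseteq> ball (of_real \<theta>) r0" using r1(2) by (auto simp: D_def)
  have \<Gamma>D: "\<Gamma> holomorphic_on D" "inj_on \<Gamma> D"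
    using \<Gamma>0 r0(3) D0 by (auto intro: holomorphic_on_subset inj_on_subset)
  have opN: "open (\<Gamma> ` D)" by (rule open_mapping_thm3[OF \<Gamma>D(1) _ \<Gamma>D(2)]) (simp add: D_def)
  have \<theta>D: "of_real \<theta> \<in> D" using r1(1) by (simp add: D_def)
  have realpt: "Im w = 0" if w: "w \<in> D" "\<Gamma> w \<in> frontier \<Omega>" for w
  proof -
    obtain u where u: "\<Gamma> w = \<gamma> u" "u \<in> {\<theta> - 1/2..\<theta> + 1/2}"
      using w(2) unfolding im[symmetric] periodic_path_image[of \<gamma>, OF per, of \<theta>] by auto
    have "\<Gamma> w \<notin> C'" using w(1) r1(2) by (auto simp: D_def)
    then have "u \<in> {\<theta> - r0<..<\<theta> + r0}" using u by (auto simp: C'_def)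
    then have "\<bar>u - \<theta>\<bar> < r0" by auto
    from eq0[OF this] u(1) w(1) D0 r0(3) have "w = of_real u" by (metis inj_onD subsetD)
    then show ?thesis by simp
  qed
  obtain w1 where w1: "w1 \<in> D" "\<Gamma> w1 \<in> \<Omega>"
  proof -
    have "\<gamma> \<theta> \<in> frontier \<Omega>"
      unfolding im[symmetric] periodic_path_image[of \<gamma>, OF per, of \<theta>] by auto
    then have "\<gamma> \<theta> \<in> closure \<Omega>" by (simp add: frontier_def)
    moreover have "\<gamma> \<theta> \<in> \<Gamma> ` D" using \<theta>D eq0[of \<theta>] r0(1) by (metis abs_zero diff_self imageI)
    ultimately have "\<Gamma> ` D \<inter> \<Omega> \<noteq> {}"
      using open_Int_closure_eq_empty[OF opN, of \<Omega>] by blast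
    then show ?thesis using that by blast
  qed
  have "Im w1 \<noteq> 0"
  proof
    assume "Im w1 = 0"
    then have w: "w1 = of_real (Re w1)" by (simp add: complex_eq_iff)
    have "w1 \<in> ball (of_real \<theta>) r0" using w1(1) D0 by blast
    then have "dist (complex_of_real \<theta>) (of_real (Re w1)) < r0" using w by simp
    then have "\<bar>Re w1 - \<theta>\<bar> < r0" by (simp add: dist_of_real dist_real_def abs_minus_commute)
    from eq0(1)[OF this] w have "\<Gamma> w1 = \<gamma> (Re w1)" by metis
    then have "\<Gamma> w1 \<in> frontier \<Omega>"
      using periodic_path_image[of \<gamma>, OF per, of "Re w1"] im by auto
    then show False using w1(2) op by (simp add: frontier_def interior_open)
  qed
  \<comment> \<open>\<open>\<sigma>\<close> marks the side of the real axis that holds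
    \<open>w1\<close>. The half-disc \<open>H\<close> on this side is connected and its image misses
    the frontier, so the whole image lies in the domain.\<close>
  define \<sigma> where "\<sigma> = sgn (Im w1)"
  have \<sigma>: "\<sigma> \<noteq> 0" using \<open>Im w1 \<noteq> 0\<close> by (simp add: \<sigma>_def sgn_0_0)
  define H where "H = D \<inter> {w. 0 < \<sigma> * Im w}"
  have "H \<subseteq> D" by (auto simp: H_def)
  have "convex {w. 0 < \<sigma> * Im w}"
    using convex_halfspace_gt[of 0 "\<i> * of_real \<sigma>"] by (simp add: inner_complex_def)
  then have "connected H"
    unfolding H_def D_def by (intro convex_connected convex_Int) auto
  then have cH: "connected (\<Gamma> ` H)"
    using \<open>H \<subseteq> D\<close> by (intro connected_continuous_image holomorphic_on_imp_continuous_on) (auto intro: holomorphic_on_subset[OF \<Gamma>D(1)])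
  have H\<Omega>: "\<Gamma> ` H \<subseteq> \<Omega>"
  proof (rule ccontr)
    assume "\<not> ?thesis"
    then have "\<Gamma> ` H - \<Omega> \<noteq> {}" by blast
    moreover have "w1 \<in> H" using w1(1) \<open>Im w1 \<noteq> 0\<close> by (auto simp: H_def \<sigma>_def sgn_if)
    then have "\<Gamma> ` H \<inter> \<Omega> \<noteq> {}" using w1(2) by blast
    ultimately have "\<Gamma> ` H \<inter> frontier \<Omega> \<noteq> {}" by (intro connected_Int_frontier[OF cH])
    then obtain w where "w \<in> H" "\<Gamma> w \<in> frontier \<Omega>" by blast
    then have "Im w = 0" using realpt \<open>H \<subseteq> D\<close> by blast
    then show False using \<open>w \<in> H\<close> by (simp add: H_def)
  qed
  obtain g where g: "g holomorphic_on \<Gamma> ` D" "\<And>z. z \<in> D \<Longrightarrow> deriv \<Gamma> z * deriv g (\<Gamma> z) = 1"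
      "\<And>z. z \<in> D \<Longrightarrow> g (\<Gamma> z) = z"
    using holomorphic_has_inverse[OF \<Gamma>D(1) _ \<Gamma>D(2)] by (auto simp: D_def)
  define p where "p = \<gamma> \<theta>"
  have p: "p = \<Gamma> (of_real \<theta>)" using eq0[of \<theta>] r0(1) by (simp add: p_def)
  then have pN: "p \<in> \<Gamma> ` D" using \<theta>D by simp
  have gp: "g p = of_real \<theta>" using g(3)[OF \<theta>D] p by simp
  have dg: "(g has_field_derivative inverse c) (at p)"
  proof -
    have "c * deriv g p = 1" using g(2)[OF \<theta>D] p by (simp add: c_def)
    then have "deriv g p = inverse c" by (metis inverse_unique)
    then show ?thesis using holomorphic_derivI[OF g(1) opN pN] by simp
  qed
  \<comment> \<open>Signed height, in the straightened coordinate, of the point at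
    \<open>\<epsilon>\<close> on the vertical line; its derivative at 0 is nonzero since Im (i / c)
    = Re c / |c|^2.\<close>
  define k where "k = (\<lambda>\<epsilon>. \<sigma> * Im (g (p + \<i> * of_real \<epsilon>)))"
  have dk: "(k has_real_derivative \<sigma> * (Re c / (norm c)\<^sup>2)) (at 0)"
  proof -
    have "((\<lambda>\<epsilon>. p + \<i> * of_real \<epsilon>) has_vector_derivative \<i>) (at 0)"
      by (auto intro!: derivative_eq_intros simp: has_vector_derivative_def scaleR_conv_of_real mult.commute)
    then have "(g \<circ> (\<lambda>\<epsilon>. p + \<i> * of_real \<epsilon>) has_vector_derivative \<i> * inverse c) (at 0)"
      using dg by (intro field_vector_diff_chain_at) auto
    then have "((\<lambda>\<epsilon>. Im (g (p + \<i> * of_real \<epsilon>))) has_vector_derivative Im (\<i> * inverse c)) (at 0)"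
      by (auto simp: o_def dest: bounded_linear.has_vector_derivative[OF bounded_linear_Im])
    then have "((\<lambda>\<epsilon>. Im (g (p + \<i> * of_real \<epsilon>))) has_real_derivative Im (\<i> * inverse c)) (at 0)"
      by (simp add: has_real_derivative_iff_has_vector_derivative)
    then have "(k has_real_derivative \<sigma> * Im (\<i> * inverse c)) (at 0)"
      unfolding k_def by (rule DERIV_cmult)
    then show ?thesis by (simp add: cmod_power2)
  qed
  have k0: "k 0 = 0" by (simp add: k_def gp)
  have "\<exists>d>0. \<exists>\<tau>. \<bar>\<tau>\<bar> = 1 \<and> (\<forall>h>0. h < d \<longrightarrow> 0 < k (\<tau> * h))"
  proof (cases "0 < \<sigma> * (Re c / (norm c)\<^sup>2)")
    case True
    from DERIV_pos_inc_right[OF dk True] k0 obtain d where "d > 0" "\<forall>h>0. h < d \<longrightarrow> 0 < k h" by auto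
    then have "\<forall>h>0. h < d \<longrightarrow> 0 < k (1 * h)" by simp
    then show ?thesis using \<open>d > 0\<close> by (intro exI[of _ d] conjI exI[of _ 1]) simp_all
  next
    case False
    then have "\<sigma> * (Re c / (norm c)\<^sup>2) < 0" using \<sigma> c \<open>c \<noteq> 0\<close> by (auto simp: less_le)
    from DERIV_neg_dec_left[OF dk this] k0 obtain d where "d > 0" "\<forall>h>0. h < d \<longrightarrow> 0 < k (- h)" by auto
    then have "\<forall>h>0. h < d \<longrightarrow> 0 < k (-1 * h)" by simp
    then show ?thesis using \<open>d > 0\<close> by (intro exI[of _ d] conjI exI[of _ "-1"]) simp_all
  qed
  then obtain d \<tau> where d: "0 < d" "\<bar>\<tau>\<bar> = 1" "\<And>h. 0 < h \<Longrightarrow> h < d \<Longrightarrow> 0 < k (\<tau> * h)" by blast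
  obtain \<delta> where \<delta>: "0 < \<delta>" "ball p \<delta> \<subseteq> \<Gamma> ` D" using opN pN by (meson open_contains_ball)
  define h where "h = min \<eta> (min d \<delta>) / 2"
  have h: "0 < h" "h < \<eta>" "h < d" "h < \<delta>" using \<eta> d(1) \<delta>(1) by (auto simp: h_def)
  have "p + \<i> * of_real (\<tau> * h) \<in> ball p \<delta>"
    using h d(2) by (simp add: dist_norm norm_mult abs_mult del: of_real_mult)
  then obtain w where w: "w \<in> D" "p + \<i> * of_real (\<tau> * h) = \<Gamma> w" using \<delta>(2) by blast
  have "0 < k (\<tau> * h)" using d(3) h by blast
  then have "w \<in> H" using w g(3)[OF w(1)] by (simp add: H_def k_def del: of_real_mult)
  then have "p + \<i> * of_real (\<tau> * h) \<in> \<Omega>" using w(2) H\<Omega> by auto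
  moreover have "\<bar>\<tau> * h\<bar> < \<eta>" using d(2) h by (simp add: abs_mult)
  ultimately show thesis using that unfolding p_def by blast
qed

text \<open>Infinitely many zeros of the derivative of the real part accumulate at some point. By
  the identity theorem the interior of the zero set is then nonempty, and it is open and closed in
  the line, so the real part would be constant.\<close>

lemma real_analytic_finite_critical:
  assumes an: "real_analytic \<gamma>" and nc: "Re (\<gamma> t1) \<noteq> Re (\<gamma> t2)"
  shows "finite {t \<in> {0..1}. Re (vector_derivative \<gamma> (at t)) = 0}"
proof (rule ccontr)
  assume inf: "infinite {t \<in> {0..1}. Re (vector_derivative \<gamma> (at t)) = 0}"
  define A where "A = {t. Re (vector_derivative \<gamma> (at t)) = 0}"
  define U where "U = {s. \<exists>e>0. \<forall>t. \<bar>t - s\<bar> < e \<longrightarrow> t \<in> A}"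
  \<comment> \<open>The identity theorem, locally: near each \<open>s\<close> either all points lie
    in \<open>A\<close>, or none except possibly \<open>s\<close>.\<close>
  have dich: "s \<in> U \<or> (\<exists>e>0. \<forall>t. 0 < \<bar>t - s\<bar> \<and> \<bar>t - s\<bar> < e \<longrightarrow> t \<notin> A)" for s
  proof -
    obtain e \<Gamma> where e: "0 < e" and \<Gamma>: "\<Gamma> holomorphic_on ball (of_real s) e"
      and \<Gamma>d: "\<And>t. \<bar>t - s\<bar> < e \<Longrightarrow> (\<gamma> has_vector_derivative deriv \<Gamma> (of_real t)) (at t)"
      by (rule real_analytic_local_extension[OF an, of s]) (rule that)
    define B where "B = ball (complex_of_real s) e"
    have B: "open B" "connected B" "of_real s \<in> B" using e by (auto simp: B_def)
    have cB: "cnj ` B = B"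
    proof -
      have *: "cnj w \<in> B" if "w \<in> B" for w
        using that unfolding B_def by (metis complex_cnj_complex_of_real complex_cnj_diff complex_mod_cnj dist_norm mem_ball)
      then show ?thesis by (auto simp: image_iff intro!: bexI[of _ "cnj _"])
    qed
    \<comment> \<open>A holomorphic function which on the real axis equals the real part of the
      velocity.\<close>
    define h where "h = (\<lambda>w. (deriv \<Gamma> w + cnj (deriv \<Gamma> (cnj w))) / 2)"
    have "deriv \<Gamma> holomorphic_on B" using \<Gamma> unfolding B_def by (intro holomorphic_deriv) auto
    moreover from this have "cnj \<circ> deriv \<Gamma> \<circ> cnj holomorphic_on B"
      using B(1) cB by (intro holomorphic_on_compose_cnj_cnj) auto
    ultimately have h: "h holomorphic_on B"
      unfolding h_def by (auto simp: o_def intro!: holomorphic_intros)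
    have mem: "of_real t \<in> B" if "\<bar>t - s\<bar> < e" for t
      using that by (simp add: B_def dist_of_real dist_real_def abs_minus_commute)
    have hA: "t \<in> A \<longleftrightarrow> h (of_real t) = 0" if "\<bar>t - s\<bar> < e" for t
    proof -
      have "vector_derivative \<gamma> (at t) = deriv \<Gamma> (of_real t)"
        using \<Gamma>d[OF that] by (rule vector_derivative_at)
      then show ?thesis by (simp add: A_def h_def complex_eq_iff)
    qed
    show ?thesis
    proof (cases "complex_of_real s islimpt {w \<in> B. h w = 0}")
      case True
      have "h w = 0" if "w \<in> B" for w
        by (rule analytic_continuation[OF h B(1,2) _ B(3) True _ that]) auto
      then have "s \<in> U" unfolding U_def using e hA mem by (auto intro!: exI[of _ e])
      then show ?thesis ..
    next
      case False
      then obtain d where d: "0 < d" "\<And>w. w \<in> B \<Longrightarrow> h w = 0 \<Longrightarrow> w \<noteq> of_real s \<Longrightarrow> d \<le> dist w (of_real s)"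
        unfolding islimpt_approachable by (force simp: not_less)
      have "t \<notin> A" if "0 < \<bar>t - s\<bar>" "\<bar>t - s\<bar> < min d e" for t
        using d(2)[OF mem, of t] hA[of t] that by (auto simp: dist_of_real dist_real_def)
      then show ?thesis using d(1) e by (intro disjI2 exI[of _ "min d e"]) auto
    qed
  qed
  have "infinite {t \<in> {0..1}. t \<in> A}" "{t \<in> {0..1}. t \<in> A} \<subseteq> {0..1}"
    using inf by (auto simp: A_def)
  then obtain s where s: "s islimpt {t \<in> {0..1}. t \<in> A}"
    using compact_Icc[of "0::real" 1] unfolding compact_eq_Bolzano_Weierstrass by meson
  have "s \<in> U"
  proof (rule ccontr)
    assume "s \<notin> U"
    then obtain e where "0 < e" "\<forall>t. 0 < \<bar>t - s\<bar> \<and> \<bar>t - s\<bar> < e \<longrightarrow> t \<notin> A" using dich by blast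
    with s show False unfolding islimpt_approachable by (auto simp: dist_real_def)
  qed
  have "open U"
    unfolding open_dist
  proof
    fix s assume "s \<in> U"
    then obtain e where e: "0 < e" "\<And>t. \<bar>t - s\<bar> < e \<Longrightarrow> t \<in> A" by (auto simp: U_def)
    have "y \<in> U" if "dist y s < e" for y
      unfolding U_def using that e(2)
      by (auto simp: dist_real_def intro!: exI[of _ "e - \<bar>y - s\<bar>"])
    then show "\<exists>e>0. \<forall>y. dist y s < e \<longrightarrow> y \<in> U" using e(1) by blast
  qed
  moreover have "open (- U)"
    unfolding open_dist
  proof
    fix s assume s: "s \<in> - U"
    then obtain e where e: "0 < e" "\<And>t. 0 < \<bar>t - s\<bar> \<Longrightarrow> \<bar>t - s\<bar> < e \<Longrightarrow> t \<notin> A" using dich by blast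
    have "U \<subseteq> A" by (auto simp: U_def)
    then have "y \<in> - U" if "dist y s < e" for y
      using e(2)[of y] s that by (cases "y = s") (auto simp: dist_real_def)
    then show "\<exists>e>0. \<forall>y. dist y s < e \<longrightarrow> y \<in> - U" using e(1) by blast
  qed
  ultimately have "U = UNIV"
    using \<open>s \<in> U\<close> connected_UNIV[where ?'a = real] unfolding connected_clopen by (force simp: closed_def)
  have "t \<in> A" for t
  proof -
    have "t \<in> U" using \<open>U = UNIV\<close> by simp
    then obtain e where "0 < e" "\<forall>u. \<bar>u - t\<bar> < e \<longrightarrow> u \<in> A" by (auto simp: U_def)
    then show "t \<in> A" by simp
  qed
  have "((\<lambda>t. Re (\<gamma> t)) has_real_derivative 0) (at t)" for t
  proof -
    have "Re (vector_derivative \<gamma> (at t)) = 0" using \<open>\<And>t. t \<in> A\<close>[of t] unfolding A_def by simp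
    with bounded_linear.has_vector_derivative[OF bounded_linear_Re real_analytic_imp_has_vector_derivative[OF an, of t]]
    show ?thesis by (simp add: has_real_derivative_iff_has_vector_derivative)
  qed
  then have "Re (\<gamma> t1) = Re (\<gamma> t2)" by (intro DERIV_isconst_all) auto
  with nc show False by simp
qed

section \<open>Jordan domains\<close>

text \<open>Move first in \<open>t\<close>, with a modulus uniform in \<open>s\<close>, then in
  \<open>s\<close> at the fixed \<open>t0\<close>.\<close>

lemma continuous_on_Times_equicontinuous:
  fixes G :: "'a::metric_space \<Rightarrow> 'b::metric_space \<Rightarrow> 'c::metric_space"
  assumes cont: "\<And>t. t \<in> T \<Longrightarrow> continuous_on S (\<lambda>s. G s t)"
    and unif: "\<And>e. 0 < e \<Longrightarrow> \<exists>d>0. \<forall>s\<in>S. \<forall>t\<in>T. \<forall>t'\<in>T. dist t t' < d \<longrightarrow> dist (G s t) (G s t') < e"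
  shows "continuous_on (S \<times> T) (\<lambda>(s, t). G s t)"
  unfolding continuous_on_iff
proof clarsimp
  fix s0 t0 and e :: real assume st: "s0 \<in> S" "t0 \<in> T" and e: "0 < e"
  obtain d1 where d1: "0 < d1" "\<And>s t t'. s \<in> S \<Longrightarrow> t \<in> T \<Longrightarrow> t' \<in> T \<Longrightarrow> dist t t' < d1 \<Longrightarrow> dist (G s t) (G s t') < e/2"
    using unif[of "e/2"] e by auto
  obtain d2 where d2: "0 < d2" "\<And>s. s \<in> S \<Longrightarrow> dist s s0 < d2 \<Longrightarrow> dist (G s t0) (G s0 t0) < e/2"
    using cont[OF st(2)] st(1) e unfolding continuous_on_iff by (metis half_gt_zero)
  show "\<exists>d>0. \<forall>s\<in>S. \<forall>t\<in>T. dist (s, t) (s0, t0) < d \<longrightarrow> dist (G s t) (G s0 t0) < e"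
  proof (intro exI[of _ "min d1 d2"] conjI ballI impI)
    fix s t assume "s \<in> S" "t \<in> T" "dist (s, t) (s0, t0) < min d1 d2"
    moreover have "dist s s0 \<le> dist (s, t) (s0, t0)" "dist t t0 \<le> dist (s, t) (s0, t0)"
      using dist_fst_le[of "(s, t)" "(s0, t0)"] dist_snd_le[of "(s, t)" "(s0, t0)"] by simp_all
    ultimately have "dist (G s t) (G s t0) < e/2" "dist (G s t0) (G s0 t0) < e/2"
      using d1(2) d2(2) st by auto
    then show "dist (G s t) (G s0 t0) < e" using dist_triangle[of "G s t" "G s0 t0" "G s t0"] by simp
  qed (use d1 d2 in auto)
qed

text \<open>The domain is one of the two components of the complement of the curve. It cannot be the
  outside one, since two translates of the complement of a bounded set always meet.\<close>

lemma bounded_domain_Jordan: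
  assumes op: "open \<Omega>" and conn: "connected \<Omega>" and ne: "\<Omega> \<noteq> {}"
    and \<gamma>: "simple_path \<gamma>" "pathfinish \<gamma> = pathstart \<gamma>" "path_image \<gamma> = frontier \<Omega>"
    and r: "0 < r"
    and disj: "translate (closure \<Omega>) (- (\<i> * of_real r)) \<inter> translate (closure \<Omega>) (\<i> * of_real r) = {}"
  shows "bounded \<Omega>" "simply_connected \<Omega>"
proof -
  define In where "In = inside (path_image \<gamma>)"
  define Out where "Out = outside (path_image \<gamma>)"
  have J: "open In" "connected In" "open Out" "connected Out" "bounded In" "In \<inter> Out = {}"
      "In \<union> Out = - path_image \<gamma>"
    using Jordan_inside_outside[OF \<gamma>(1,2)] by (auto simp: In_def Out_def)
  have "\<Omega> \<inter> frontier \<Omega> = {}" using op by (auto simp: frontier_def interior_open)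
  then have sub: "\<Omega> \<subseteq> In \<union> Out" unfolding J(7) \<gamma>(3) by blast
  have max: "A \<subseteq> \<Omega>" if "connected A" "A \<inter> frontier \<Omega> = {}" "A \<inter> \<Omega> \<noteq> {}" for A
    using connected_Int_frontier[of A \<Omega>] that by blast
  have "In \<inter> frontier \<Omega> = {}" "Out \<inter> frontier \<Omega> = {}" using J(7) \<gamma>(3) by auto
  then have InOut: "\<Omega> = In \<or> \<Omega> = Out"
  proof -
    have "In \<inter> \<Omega> = {} \<or> Out \<inter> \<Omega> = {}"
      by (rule connectedD[OF conn J(1,3)]) (use J(6) sub in auto)
    then show ?thesis
    proof
      assume *: "In \<inter> \<Omega> = {}"
      then have "Out \<inter> \<Omega> \<noteq> {}" using sub ne by blast
      with max[OF J(4)] \<open>Out \<inter> frontier \<Omega> = {}\<close> sub * show ?thesis by blast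
    next
      assume *: "Out \<inter> \<Omega> = {}"
      then have "In \<inter> \<Omega> \<noteq> {}" using sub ne by blast
      with max[OF J(2)] \<open>In \<inter> frontier \<Omega> = {}\<close> sub * show ?thesis by blast
    qed
  qed
  have "\<Omega> = In"
  proof (rule ccontr)
    assume "\<Omega> \<noteq> In"
    then have "\<Omega> = Out" using InOut by simp
    then have "- \<Omega> = In \<union> path_image \<gamma>" using J(6,7) by blast
    then have "bounded (- \<Omega>)"
      using J(5) \<gamma>(1) by (simp add: bounded_path_image simple_path_imp_path)
    then obtain B where B: "\<And>w. w \<notin> \<Omega> \<Longrightarrow> norm w \<le> B" "0 < B" by (auto simp: bounded_pos)
    \<comment> \<open>Chosen so high that \<open>p - \<i> * of_real r\<close> and
      \<open>p + \<i> * of_real r\<close> both have norm above \<open>B\<close>.\<close>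
    define p where "p = \<i> * of_real (B + 1 + r)"
    have "norm (p + \<i> * of_real r) = B + 1 + 2 * r" "norm (p - \<i> * of_real r) = B + 1"
    proof -
      have "p + \<i> * of_real r = \<i> * of_real (B + 1 + 2 * r)" "p - \<i> * of_real r = \<i> * of_real (B + 1)"
        by (simp_all add: p_def algebra_simps)
      then show "norm (p + \<i> * of_real r) = B + 1 + 2 * r" "norm (p - \<i> * of_real r) = B + 1"
        using B(2) r by (simp_all only: norm_mult norm_of_real norm_ii) auto
    qed
    then have "p + \<i> * of_real r \<in> \<Omega>" "p - \<i> * of_real r \<in> \<Omega>"
      using B r by force+
    then have "p + \<i> * of_real r \<in> closure \<Omega>" "p - \<i> * of_real r \<in> closure \<Omega>"
      using closure_subset by blast+
    then have "p \<in> translate (closure \<Omega>) (- (\<i> * of_real r))" "p \<in> translate (closure \<Omega>) (\<i> * of_real r)"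
      unfolding translate_def by (force simp: image_iff)+
    then show False using disj by blast
  qed
  then show "bounded \<Omega>" "simply_connected \<Omega>"
    using J(5) simply_connected_inside_simple_path[OF \<gamma>(1)] by (simp_all add: In_def)
qed

lemma cnj_closure:
  assumes "cnj ` \<Omega> = \<Omega>" "s \<in> closure \<Omega>"
  shows "cnj s \<in> closure \<Omega>"
  using image_closure_subset[of \<Omega> cnj "closure \<Omega>"] assms closure_subset[of \<Omega>]
  by (auto intro: continuous_intros)

text \<open>If the closure reached height \<open>r\<close>, it would contain some \<open>w\<close>
  at exactly that height, and \<open>cnj w\<close>; moved down and up by \<open>r\<close>, both land
  on \<open>Re w\<close>, against disjointness.\<close>

lemma height_less:
  assumes conn: "connected \<Omega>" and ne: "\<Omega> \<noteq> {}" and sym: "cnj ` \<Omega> = \<Omega>" and r: "0 < r"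
    and disj: "translate (closure \<Omega>) (- (\<i> * of_real r)) \<inter> translate (closure \<Omega>) (\<i> * of_real r) = {}"
    and s: "s \<in> closure \<Omega>"
  shows "\<bar>Im s\<bar> < r"
proof (rule ccontr)
  assume "\<not> \<bar>Im s\<bar> < r"
  then obtain b where b: "b \<in> closure \<Omega>" "r \<le> Im b"
    using s cnj_closure[OF sym s] by (cases "0 \<le> Im s") auto
  obtain p where p: "p \<in> \<Omega>" "Im p = 0"
    using connected_symmetric_real_point[OF conn ne sym] by blast
  have "connected (Im ` closure \<Omega>)"
    using conn by (intro connected_continuous_image continuous_intros connected_imp_connected_closure)
  moreover have "Im p \<in> Im ` closure \<Omega>" "Im b \<in> Im ` closure \<Omega>"
    using p b closure_subset by blast+
  ultimately have "r \<in> Im ` closure \<Omega>"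
    by (rule connectedD_interval) (use p b r in auto)
  then obtain w where w: "w \<in> closure \<Omega>" "Im w = r" by blast
  have "of_real (Re w) = w + - (\<i> * of_real r)" "of_real (Re w) = cnj w + \<i> * of_real r"
    using w(2) by (simp_all add: complex_eq_iff)
  then have "of_real (Re w) \<in> translate (closure \<Omega>) (- (\<i> * of_real r)) \<inter> translate (closure \<Omega>) (\<i> * of_real r)"
    unfolding translate_def using w(1) cnj_closure[OF sym w(1)] by blast
  then show False using disj by blast
qed

text \<open>Every vertical line through a point of the bounded domain must leave it through the
  frontier, and an open set meets more than one such line. Used to rule out a constant real part of
  the boundary curve.\<close>

lemma frontier_Re_not_constant:
  assumes op: "open \<Omega>" and bdd: "bounded \<Omega>" and ne: "\<Omega> \<noteq> {}"
  obtains a b where "a \<in> frontier \<Omega>" "b \<in> frontier \<Omega>" "Re a \<noteq> Re b"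
proof -
  have meets: "\<exists>a\<in>frontier \<Omega>. Re a = Re s" if "s \<in> \<Omega>" for s
  proof -
    have "convex {w. Re w = Re s}"
      using convex_hyperplane[of "1::complex" "Re s"] by (simp add: inner_complex_def)
    then have "connected {w. Re w = Re s}" by (rule convex_connected)
    moreover have "{w. Re w = Re s} - \<Omega> \<noteq> {}"
    proof -
      obtain B where B: "\<And>w. w \<in> \<Omega> \<Longrightarrow> norm w \<le> B" using bdd by (auto simp: bounded_iff)
      have "B < norm (Complex (Re s) (\<bar>B\<bar> + 1))"
        using abs_Im_le_cmod[of "Complex (Re s) (\<bar>B\<bar> + 1)"] by simp
      then have "Complex (Re s) (\<bar>B\<bar> + 1) \<notin> \<Omega>" using B by force
      then show ?thesis by (metis (mono_tags, lifting) DiffI complex.sel(1) empty_iff mem_Collect_eq)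
    qed
    ultimately have "{w. Re w = Re s} \<inter> frontier \<Omega> \<noteq> {}"
      using that by (intro connected_Int_frontier) auto
    then show ?thesis by blast
  qed
  obtain s where s: "s \<in> \<Omega>" using ne by blast
  then obtain e where e: "0 < e" "ball s e \<subseteq> \<Omega>" using op by (meson open_contains_ball)
  have "s + of_real (e/2) \<in> ball s e"
    using e(1) unfolding mem_ball dist_norm by (simp add: norm_divide)
  then have "s + of_real (e/2) \<in> \<Omega>" using e by blast
  from meets[OF s] meets[OF this] e(1) that show thesis by fastforce
qed

section \<open>Holomorphy on the interior of the sweep\<close>

theorem theorem2p1:
  fixes \<Omega> :: "complex set" and r :: real and f :: "complex \<Rightarrow> complex"
  assumes "open \<Omega>" and "connected \<Omega>" and "\<Omega> \<noteq> {}"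
    and "cnj ` \<Omega> = \<Omega>"
    and "real_analytic_simple_closed_curve (frontier \<Omega>)"
    and "r > 0"
    and "continuous_on (vertical_sweep (frontier \<Omega>) r) f"
    and "\<And>t. -r \<le> t \<Longrightarrow> t \<le> r \<Longrightarrow>
           \<exists>g. continuous_on (translate (closure \<Omega>) (\<i> * of_real t)) g \<and>
               g holomorphic_on translate \<Omega> (\<i> * of_real t) \<and>
               (\<forall>z\<in>translate (frontier \<Omega>) (\<i> * of_real t). g z = f z)"
    and "translate (closure \<Omega>) (- (\<i> * of_real r)) \<inter> translate (closure \<Omega>) (\<i> * of_real r) = {}"
  shows "f holomorphic_on interior (vertical_sweep (frontier \<Omega>) r)"
proof -
  obtain \<gamma> where \<gamma>: "real_analytic \<gamma>" "\<And>t. \<gamma> (t + 1) = \<gamma> t" "simple_path \<gamma>" "path_image \<gamma> = frontier \<Omega>"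
    using assms(5) unfolding real_analytic_simple_closed_curve_def by blast
  have loop: "pathfinish \<gamma> = pathstart \<gamma>"
    using \<gamma>(2)[of 0] by (simp add: pathfinish_def pathstart_def)
  note bdd = bounded_domain_Jordan[OF assms(1-3) \<gamma>(3) loop \<gamma>(4) assms(6,9)]
  have height_closure: "\<bar>Im s\<bar> < r" if "s \<in> closure \<Omega>" for s
    using height_less[OF assms(2-4,6,9) that] .
  have comp: "compact (closure \<Omega>)" "closure \<Omega> \<noteq> {}" using bdd(1) assms(3) by auto
  have "continuous_on (closure \<Omega>) Im" by (intro continuous_intros)
  then obtain b where b: "b \<in> closure \<Omega>" "\<And>s. s \<in> closure \<Omega> \<Longrightarrow> Im s \<le> Im b"
    using continuous_attains_sup[OF comp] by blast
  define m where "m = Im b"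
  define K where "K = vertical_sweep (frontier \<Omega>) r"
  have inK: "z \<in> K \<longleftrightarrow> (\<exists>t\<in>{-r..r}. z - \<i> * of_real t \<in> frontier \<Omega>)" for z
    unfolding K_def vertical_sweep_def translate_def by (force simp: image_iff)
  have "K = (\<lambda>(s, t). s + \<i> * of_real t) ` (frontier \<Omega> \<times> {-r..r})"
    unfolding K_def vertical_sweep_def translate_def by auto
  then have compK: "compact K"
    using bdd(1) by (auto intro!: compact_continuous_image compact_Times compact_frontier_bounded
        continuous_intros simp: case_prod_unfold)
  have fK: "continuous_on K f" using assms(7) by (simp add: K_def)
  obtain B where B: "0 < B" "\<And>z. z \<in> K \<Longrightarrow> norm (f z) \<le> B"
    using compact_imp_bounded[OF compact_continuous_image[OF fK compK]] by (auto simp: bounded_pos)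
  have "closedin (top_of_set UNIV) K"
    using compact_imp_closed[OF compK] by simp
  then obtain F where F: "continuous_on UNIV F" "\<And>z. z \<in> K \<Longrightarrow> F z = f z"
    using Tietze[OF fK _ less_imp_le[OF B(1)] B(2)] by metis
  have ex: "\<forall>t\<in>{-r..r}. \<exists>g. continuous_on (translate (closure \<Omega>) (\<i> * of_real t)) g \<and>
               g holomorphic_on translate \<Omega> (\<i> * of_real t) \<and>
               (\<forall>z\<in>translate (frontier \<Omega>) (\<i> * of_real t). g z = f z)"
    using assms(8) by auto
  obtain g where g_ex: "\<forall>t\<in>{-r..r}. continuous_on (translate (closure \<Omega>) (\<i> * of_real t)) (g t) \<and>
               g t holomorphic_on translate \<Omega> (\<i> * of_real t) \<and>
               (\<forall>z\<in>translate (frontier \<Omega>) (\<i> * of_real t). g t z = f z)"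
    using bchoice[OF ex] ..
  then have g: "\<And>t. t \<in> {-r..r} \<Longrightarrow> continuous_on (translate (closure \<Omega>) (\<i> * of_real t)) (g t)"
      "\<And>t. t \<in> {-r..r} \<Longrightarrow> g t holomorphic_on translate \<Omega> (\<i> * of_real t)"
      "\<And>t z. t \<in> {-r..r} \<Longrightarrow> z \<in> translate (frontier \<Omega>) (\<i> * of_real t) \<Longrightarrow> g t z = f z"
    by simp_all
  define G where "G = (\<lambda>s t. g t (s + \<i> * of_real t))"
  have G1: "continuous_on (closure \<Omega>) (\<lambda>s. G s t)" if "t \<in> {-r..r}" for t
    unfolding G_def
    by (rule continuous_on_compose2[OF g(1)[OF that]]) (auto simp: translate_def intro!: continuous_intros)
  have G2: "(\<lambda>s. G s t) holomorphic_on \<Omega>" if "t \<in> {-r..r}" for t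
  proof -
    have "(g t \<circ> (\<lambda>s. s + \<i> * of_real t)) holomorphic_on \<Omega>"
      by (rule holomorphic_on_compose_gen[OF _ g(2)[OF that]]) (auto simp: translate_def intro!: holomorphic_intros)
    then show ?thesis by (simp add: G_def o_def)
  qed
  have G3: "G s t = F (s + \<i> * of_real t)" "s + \<i> * of_real t \<in> K" if "s \<in> frontier \<Omega>" "t \<in> {-r..r}" for s t
  proof -
    show *: "s + \<i> * of_real t \<in> K" unfolding inK using that by (intro bexI[of _ t]) auto
    show "G s t = F (s + \<i> * of_real t)"
      unfolding G_def using g(3)[OF that(2), of "s + \<i> * of_real t"] F(2)[OF *] that by (auto simp: translate_def)
  qed
  \<comment> \<open>Boundary values at nearby \<open>t\<close> are uniformly close because
    \<open>F\<close> is uniformly continuous on the compact \<open>K\<close>; the maximum principle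
    carries this into the domain.\<close>
  have G4: "continuous_on (closure \<Omega> \<times> {-r..r}) (\<lambda>(s, t). G s t)"
  proof (rule continuous_on_Times_equicontinuous[OF G1])
    fix e :: real assume e: "0 < e"
    have "uniformly_continuous_on K F"
      using F(1) compK by (intro compact_uniformly_continuous) (auto intro: continuous_on_subset)
    then obtain d where d: "0 < d" "\<And>x y. x \<in> K \<Longrightarrow> y \<in> K \<Longrightarrow> dist x y < d \<Longrightarrow> dist (F x) (F y) < e/2"
      unfolding uniformly_continuous_on_def using e by (metis half_gt_zero)
    have "dist (G s t) (G s t') < e" if t: "t \<in> {-r..r}" "t' \<in> {-r..r}" "dist t t' < d" and s: "s \<in> closure \<Omega>" for s t t'
    proof -
      have fr: "norm (G w t - G w t') \<le> e/2" if "w \<in> frontier \<Omega>" for w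
      proof -
        have "dist (w + \<i> * of_real t) (w + \<i> * of_real t') = dist t t'"
          unfolding dist_norm by (simp add: right_diff_distrib[symmetric] norm_mult del: of_real_diff flip: of_real_diff)
        then show ?thesis
          using d(2)[OF G3(2)[OF that t(1)] G3(2)[OF that t(2)]] t(3) G3(1)[OF that t(1)] G3(1)[OF that t(2)]
          by (simp add: dist_norm less_imp_le)
      qed
      have "norm (G s t - G s t') \<le> e/2"
      proof (cases "s \<in> \<Omega>")
        case True
        show ?thesis
        proof (rule maximum_modulus_frontier[of "\<lambda>w. G w t - G w t'" \<Omega>])
          show "(\<lambda>w. G w t - G w t') holomorphic_on interior \<Omega>"
            using assms(1) by (simp add: interior_open) (intro holomorphic_intros G2 t)
          show "continuous_on (closure \<Omega>) (\<lambda>w. G w t - G w t')"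
            by (intro continuous_intros G1 t)
        qed (use bdd fr True in auto)
      next
        case False
        then show ?thesis using fr s assms(1) by (simp add: frontier_def interior_open)
      qed
      then show ?thesis using e by (simp add: dist_norm)
    qed
    then show "\<exists>d>0. \<forall>s\<in>closure \<Omega>. \<forall>t\<in>{-r..r}. \<forall>t'\<in>{-r..r}. dist t t' < d \<longrightarrow> dist (G s t) (G s t') < e"
      using d(1) by blast
  qed
  have "translated_family \<Omega> r m F G"
  proof
    show "\<bar>Im s\<bar> \<le> m" if "s \<in> \<Omega>" for s
    proof -
      have "s \<in> closure \<Omega>" using that closure_subset by blast
      then show ?thesis
        using b(2)[of s] b(2)[OF cnj_closure[OF assms(4)], of s] by (auto simp: m_def)
    qed
    show "m < r" using height_closure[OF b(1)] by (simp add: m_def)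
    show "\<exists>s\<in>closure \<Omega>. Im s = m" using b(1) by (auto simp: m_def)
  qed (use assms(1,3,4) bdd F(1) G2 G3(1) G4 in auto)
  then interpret translated_family \<Omega> r m F G .
  define W where "W = {z. \<exists>t. \<bar>t\<bar> < r \<and> z - \<i> * of_real t \<in> \<Omega>}"
  \<comment> \<open>The real parts of the points of the curve with a vertical tangent. Off these
    lines a frontier point can be moved vertically into the domain.\<close>
  define X where "X = (\<lambda>t. Re (\<gamma> t)) ` {t \<in> {0..1}. Re (vector_derivative \<gamma> (at t)) = 0}"
  have "finite X"
  proof -
    obtain a b where "a \<in> path_image \<gamma>" "b \<in> path_image \<gamma>" "Re a \<noteq> Re b"
      using frontier_Re_not_constant[OF assms(1) bdd(1) assms(3)] \<gamma>(4) by metis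
    then obtain t1 t2 where "Re (\<gamma> t1) \<noteq> Re (\<gamma> t2)" by (auto simp: path_image_def)
    then show ?thesis unfolding X_def using real_analytic_finite_critical[OF \<gamma>(1)] by blast
  qed
  have W_from_boundary: "z \<in> W" if z: "z - \<i> * of_real t \<in> frontier \<Omega>" "\<bar>t\<bar> < r" "Re z \<notin> X" for z t
  proof -
    obtain \<theta> where \<theta>: "\<theta> \<in> {0..1}" "\<gamma> \<theta> = z - \<i> * of_real t"
      using z(1) unfolding \<gamma>(4)[symmetric] path_image_def by force
    then have "Re (\<gamma> \<theta>) = Re z" by simp
    then have "Re (vector_derivative \<gamma> (at \<theta>)) \<noteq> 0" using z(3) \<theta>(1) unfolding X_def by force
    then obtain \<epsilon> where \<epsilon>: "\<bar>\<epsilon>\<bar> < r - \<bar>t\<bar>" "\<gamma> \<theta> + \<i> * of_real \<epsilon> \<in> \<Omega>"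
      using vertical_line_meets_domain[OF \<gamma> assms(1), of \<theta> "r - \<bar>t\<bar>"] z(2) by auto
    have "\<gamma> \<theta> + \<i> * of_real \<epsilon> = z - \<i> * of_real (t - \<epsilon>)"
      unfolding \<theta>(2) by (simp add: algebra_simps)
    then show ?thesis using \<epsilon> unfolding W_def by (intro CollectI exI[of _ "t - \<epsilon>"]) auto
  qed
  have height_frontier: "\<bar>Im w\<bar> < r" if "w \<in> frontier \<Omega>" for w
    using that height_closure by (simp add: frontier_def)
  \<comment> \<open>Shifting \<open>z\<close> up and down inside \<open>K\<close> gives two
    candidate parameters, \<open>t1 - \<eta>\<close> and \<open>t2 + \<eta>\<close>. If both were
    out of range, the height bound on the frontier would force \<open>Im z\<close> to be both
    negative and positive.\<close>
  have in_W: "z \<in> W" if z: "z \<in> interior K" "Re z \<notin> X" for z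
  proof -
    obtain e where e: "0 < e" "ball z e \<subseteq> K" using z(1) by (meson mem_interior)
    define \<eta> where "\<eta> = e / 2"
    have "z + \<i> * of_real \<eta> \<in> ball z e" "z - \<i> * of_real \<eta> \<in> ball z e"
      using e(1) by (simp_all add: \<eta>_def dist_norm norm_mult norm_divide)
    then have "z + \<i> * of_real \<eta> \<in> K" "z - \<i> * of_real \<eta> \<in> K" using e(2) by blast+
    then obtain t1 t2 where t: "t1 \<in> {-r..r}" "t2 \<in> {-r..r}"
       "z + \<i> * of_real \<eta> - \<i> * of_real t1 \<in> frontier \<Omega>" "z - \<i> * of_real \<eta> - \<i> * of_real t2 \<in> frontier \<Omega>"
      unfolding inK by blast
    have eq: "z + \<i> * of_real \<eta> - \<i> * of_real t1 = z - \<i> * of_real (t1 - \<eta>)"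
        "z - \<i> * of_real \<eta> - \<i> * of_real t2 = z - \<i> * of_real (t2 + \<eta>)"
      by (simp_all add: algebra_simps)
    have fr: "z - \<i> * of_real (t1 - \<eta>) \<in> frontier \<Omega>" "z - \<i> * of_real (t2 + \<eta>) \<in> frontier \<Omega>"
      using t(3,4) unfolding eq .
    have "\<eta> > 0" using e(1) by (simp add: \<eta>_def)
    consider "\<bar>t1 - \<eta>\<bar> < r" | "\<bar>t2 + \<eta>\<bar> < r" | "t1 - \<eta> \<le> - r" "r \<le> t2 + \<eta>"
      using t(1,2) \<open>\<eta> > 0\<close> by fastforce
    then show ?thesis
    proof cases
      case 3
      then show ?thesis using height_frontier[OF fr(1)] height_frontier[OF fr(2)] by simp
    qed (use fr W_from_boundary z(2) in blast)+
  qed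
  have FW: "F holomorphic_on W" unfolding W_def by (rule F_holomorphic_on_open_sweep)
  have "F holomorphic_on interior K"
    unfolding holomorphic_on_def
  proof
    fix z assume z: "z \<in> interior K"
    obtain e1 where e1: "0 < e1" "ball z e1 \<subseteq> interior K"
      using z open_interior by (meson open_contains_ball)
    obtain e2 where e2: "0 < e2" "\<And>x. x \<in> X \<Longrightarrow> x \<noteq> Re z \<Longrightarrow> e2 \<le> dist (Re z) x"
      using finite_set_avoid[OF \<open>finite X\<close>, of "Re z"] by blast
    define B where "B = ball z (min e1 e2)"
    \<comment> \<open>In this small disc only the vertical line through \<open>z\<close> can lie
      outside \<open>W\<close>; the continuous \<open>F\<close> is then holomorphic across
      it.\<close>
    have BW: "w \<in> W" if "w \<in> B" "Re w \<noteq> Re z" for w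
    proof (rule in_W)
      show "w \<in> interior K" using that(1) e1(2) by (auto simp: B_def)
      have "\<bar>Re z - Re w\<bar> < e2"
        using that(1) abs_Re_le_cmod[of "z - w"] by (simp add: B_def dist_norm)
      then show "Re w \<notin> X" using e2(2)[of "Re w"] that(2) by (auto simp: dist_real_def)
    qed
    have "F holomorphic_on B"
    proof (rule holomorphic_on_paste_across_line[of B 1 F "Re z"])
      show "F holomorphic_on B \<inter> {w. 1 \<bullet> w < Re z}" "F holomorphic_on B \<inter> {w. Re z < 1 \<bullet> w}"
        unfolding inner_complex_def using BW by (intro holomorphic_on_subset[OF FW]; auto)+
      show "continuous_on B F" using F(1) by (rule continuous_on_subset) auto
    qed (auto simp: B_def)
    then have "F field_differentiable at z"
      using e1(1) e2(1) by (intro holomorphic_on_imp_differentiable_at[of F B]) (auto simp: B_def)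
    then show "F field_differentiable at z within interior K" by (rule field_differentiable_at_within)
  qed
  then have "f holomorphic_on interior K"
    by (rule holomorphic_transform) (use F(2) interior_subset in blast)
  then show ?thesis by (simp add: K_def)
qed

end
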